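(* For each $r\ge 2$ and each $\pi\in\Pi_1(\{1,\dots,r\})$, the map $\psi_\pi:\mathcal{C}(\pi)\to\mathcal{E}(\pi)$ defined by the construction in the context is a bijection.
   Context: An unordered increasing tree is a rooted tree on distinct positive integers, sons unordered, each son larger than its father. $\Pi_1(\{1,\dots,r\})$ is the set of set partitions of $\{1,\dots,r\}$ having $\{1\}$ as a block; for such $\pi$ with $k$ blocks, index them $\pi_1,\dots,\pi_k$ so that $\mu_i=\max\pi_i$ satisfy $1=\mu_1<\dots<\mu_k=r$. $\mathcal{E}(\pi)$ is the set of unordered increasing trees on $\{1,\dots,r\}$ in which, for every two elements $i<j$ of the same block of $\pi$, $i$ is an ancestor of $j$. $\mathcal{C}(\pi)=\{(c_2,\dots,c_{k-1}):1\le c_i\le\mu_i\}$ (only the empty list if $k=2$). $v$-decomposition: for a vertex $v$ of an unordered increasing tree $T$ with chain $a_1<\dots<a_k=v$ from the root to $v$, removing the chain edges gives components $T^{(a_i)}$ rooted at $a_i$. Splice: for unordered increasing trees $T_1,T_2$ with disjoint vertex-sets and $v_1\in V(T_1)$, $v_2\in V(T_2)$, $v_1>v_2$, $\mathrm{spl}(T_1,v_1;T_2,v_2)$ is the tree on $V(T_1)\cup V(T_2)$ obtained by merging the root-to-$v_1$ chain of $T_1$ and the root-to-$v_2$ chain of $T_2$ into one increasing chain (root = smallest element, ending at $v_1$) and attaching at each chain vertex its component from the $v_1$-decomposition of $T_1$ or the $v_2$-decomposition of $T_2$. Construction of $\psi_\pi(c)$ for $c=(c_2,\dots,c_{k-1})\in\mathcal{C}(\pi)$: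 Stage 1: let $\tau_\ell$ be the increasing chain on the elements of $\pi_\ell$ ($\ell=1,\dots,k$), and set $\nu=1$. For $i=2,\dots,k-1$: if $c_i$ is a vertex of $\tau_1$ or $\tau_i$, replace $\tau_1$ by $\mathrm{spl}(\tau_i,\mu_i;\tau_1,\nu)$, discard $\tau_i$, and set $\nu=c_i$; otherwise $c_i$ is a vertex of some $\tau_j$ with $j>i$, and then replace $\tau_j$ by $\mathrm{spl}(\tau_i,\mu_i;\tau_j,c_i)$ and discard $\tau_i$. Finally $\psi_\pi(c)=\mathrm{spl}(\tau_k,\mu_k;\tau_1,\nu)$. *)

theory Defs
  imports Main "HOL-Library.Disjoint_Sets"
begin

text \<open>A rooted tree on a finite vertex set V of positive integers is represented by
  the pair (V, p) of its vertex set and its parent function p; the parent function is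
  normalised to 0 outside V and at the root. Since sons are unordered, such a tree is
  determined by this pair.\<close>

type_synonym itree = "nat set \<times> (nat \<Rightarrow> nat)"

definition inc_tree :: "itree \<Rightarrow> bool" where
  "inc_tree T \<longleftrightarrow> (let V = fst T; p = snd T in
     finite V \<and> V \<noteq> {} \<and> 0 \<notin> V \<and>
     (\<forall>v\<in>V. v \<noteq> Min V \<longrightarrow> p v \<in> V \<and> p v < v) \<and>
     (\<forall>v. (v \<notin> V \<or> v = Min V) \<longrightarrow> p v = 0))"

definition anc :: "(nat \<Rightarrow> nat) \<Rightarrow> nat \<Rightarrow> nat \<Rightarrow> bool" where
  "anc p u v \<longleftrightarrow> (\<exists>k. (p ^^ k) v = u)"

definition chain_to :: "itree \<Rightarrow> nat \<Rightarrow> nat set" where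
  "chain_to T v = {a \<in> fst T. anc (snd T) a v}"

definition chain_par :: "nat set \<Rightarrow> nat \<Rightarrow> nat" where
  "chain_par S u = (if u \<in> S \<and> u \<noteq> Min S then Max {a \<in> S. a < u} else 0)"

definition chain_tree :: "nat set \<Rightarrow> itree" where
  "chain_tree S = (S, chain_par S)"

text \<open>Splice: chain vertices get their predecessor in the merged chain; every other
  vertex keeps its parent (i.e. its component of the decomposition is reattached
  at the same chain vertex).\<close>
definition spl :: "itree \<Rightarrow> nat \<Rightarrow> itree \<Rightarrow> nat \<Rightarrow> itree" where
  "spl T1 v1 T2 v2 =
    (let C = chain_to T1 v1 \<union> chain_to T2 v2 in
     (fst T1 \<union> fst T2,
      \<lambda>u. if u \<in> C then chain_par C u
          else if u \<in> fst T1 then snd T1 u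
          else if u \<in> fst T2 then snd T2 u else 0))"

definition Pi1 :: "nat \<Rightarrow> nat set set set" where
  "Pi1 r = {\<pi>. partition_on {1..r} \<pi> \<and> {1} \<in> \<pi>}"

definition mu :: "nat set set \<Rightarrow> nat \<Rightarrow> nat" where
  "mu \<pi> i = sorted_list_of_set (Max ` \<pi>) ! (i - 1)"

definition blk :: "nat set set \<Rightarrow> nat \<Rightarrow> nat set" where
  "blk \<pi> i = (THE B. B \<in> \<pi> \<and> Max B = mu \<pi> i)"

definition Eset :: "nat \<Rightarrow> nat set set \<Rightarrow> itree set" where
  "Eset r \<pi> = {T. inc_tree T \<and> fst T = {1..r} \<and>
     (\<forall>B\<in>\<pi>. \<forall>i\<in>B. \<forall>j\<in>B. i < j \<longrightarrow> anc (snd T) i j)}"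

definition Cset :: "nat set set \<Rightarrow> nat list set" where
  "Cset \<pi> = {c. length c = card \<pi> - 2 \<and>
     (\<forall>i\<in>{2..card \<pi> - 1}. c ! (i - 2) \<in> {1..mu \<pi> i})}"

definition psi_step :: "nat set set \<Rightarrow> nat list \<Rightarrow> (nat \<Rightarrow> itree) \<times> nat \<Rightarrow> nat
     \<Rightarrow> (nat \<Rightarrow> itree) \<times> nat" where
  "psi_step \<pi> c st i =
    (let \<tau> = fst st; \<nu> = snd st; ci = c ! (i - 2) in
     if ci \<in> fst (\<tau> 1) \<union> fst (\<tau> i)
     then (\<tau>(1 := spl (\<tau> i) (mu \<pi> i) (\<tau> 1) \<nu>), ci)
     else (let j = (THE j. i < j \<and> j \<le> card \<pi> \<and> ci \<in> fst (\<tau> j)) in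
           (\<tau>(j := spl (\<tau> i) (mu \<pi> i) (\<tau> j) ci), \<nu>)))"

definition psi :: "nat set set \<Rightarrow> nat list \<Rightarrow> itree" where
  "psi \<pi> c =
    (let k = card \<pi>;
         st = foldl (psi_step \<pi> c) (\<lambda>l. chain_tree (blk \<pi> l), 1) [2..<k]
     in spl (fst st k) (mu \<pi> k) (fst st 1) (snd st))"

end

theory Submission
  imports Defs
begin

text \<open>Encode an increasing tree by its ancestor order. Then splicing is given by a first-order
  formula, and its inverse is restriction of the order to two complementary vertex sets.

  Given a tree \<open>T\<close> containing the block with maximum \<open>m\<close>, let \<open>h y\<close> be the deepest common ancestor
  of \<open>y\<close> and \<open>m\<close>, and \<open>f x\<close> the maximum of the block of \<open>x\<close>. Iterating \<open>h \<circ> f\<close> splits the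
  vertices of \<open>T\<close> into classes, one for each fixed point. Before step \<open>i\<close>, every tree \<open>\<tau> l\<close> with
  \<open>l \<ge> i\<close> consists of a single class with respect to \<open>\<mu> l\<close>; so, after \<open>\<tau> i\<close> has been spliced into
  some tree, it is recovered as the class of \<open>\<mu> i\<close>. Conversely, the class of \<open>\<mu> i\<close> can
  always be split off: the root \<open>1\<close>, respectively the maximum \<open>\<mu> j\<close> of the tree concerned, lies in
  another class. Hence each step is a bijection from pairs (state, admissible \<open>c\<close>) to states,
  and so is the final splice from states to \<open>Eset r \<pi>\<close>.\<close>

section \<open>Increasing trees as orders\<close>

text \<open>Iterating the parent function eventually yields the default value \<open>0\<close>,
  which \<open>anc\<close> counts as an ancestor of every vertex; restricting to the vertex set
  removes it.\<close>

definition le :: "itree \<Rightarrow> nat \<Rightarrow> nat \<Rightarrow> bool" where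
  "le T a x \<longleftrightarrow> a \<in> fst T \<and> x \<in> fst T \<and> anc (snd T) a x"

text \<open>By \<open>inc_tree_order\<close> and \<open>ex_tree\<close> these axioms characterise
  the ancestor orders of increasing trees. The tree property is \<open>lin\<close>: the ancestors of
  a vertex form a chain, sorted by size.\<close>

locale inc_order =
  fixes V :: "nat set" and R :: "nat \<Rightarrow> nat \<Rightarrow> bool"
  assumes fin: "finite V" and ne: "V \<noteq> {}" and pos: "0 \<notin> V"
    and dom: "R a x \<Longrightarrow> a \<in> V \<and> x \<in> V \<and> a \<le> x"
    and refl: "x \<in> V \<Longrightarrow> R x x"
    and trans: "R a x \<Longrightarrow> R x y \<Longrightarrow> R a y"
    and lin: "R a x \<Longrightarrow> R b x \<Longrightarrow> a \<le> b \<Longrightarrow> R a b"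
    and root: "x \<in> V \<Longrightarrow> R (Min V) x"

lemma anc_rec: "anc p a x \<longleftrightarrow> a = x \<or> anc p a (p x)"
proof
  assume "anc p a x"
  then obtain n where n: "(p ^^ n) x = a" unfolding anc_def by blast
  show "a = x \<or> anc p a (p x)"
  proof (cases n)
    case (Suc m)
    then show ?thesis using n by (auto simp: anc_def funpow_Suc_right simp del: funpow.simps)
  qed (use n in auto)
next
  assume "a = x \<or> anc p a (p x)"
  then show "anc p a x"
  proof
    assume "a = x"
    then show ?thesis unfolding anc_def by (metis funpow_0)
  next
    assume "anc p a (p x)"
    then obtain n where "(p ^^ n) (p x) = a" unfolding anc_def by blast
    then have "(p ^^ Suc n) x = a" by (simp add: funpow_Suc_right del: funpow.simps)
    then show ?thesis unfolding anc_def by blast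
  qed
qed

lemma anc_zero: "p 0 = 0 \<Longrightarrow> anc p a 0 \<longleftrightarrow> a = 0"
proof -
  assume "p 0 = 0"
  then have "(p ^^ n) 0 = 0" for n by (induction n) auto
  then show ?thesis unfolding anc_def by auto
qed

lemma inc_treeD:
  assumes "inc_tree T"
  shows "finite (fst T)" "fst T \<noteq> {}" "0 \<notin> fst T"
    "v \<in> fst T \<Longrightarrow> v \<noteq> Min (fst T) \<Longrightarrow> snd T v \<in> fst T \<and> snd T v < v"
    "v \<notin> fst T \<or> v = Min (fst T) \<Longrightarrow> snd T v = 0"
  using assms by (auto simp: inc_tree_def Let_def)

text \<open>Parents are smaller than their sons, so this recursion supports strong induction on the
  lower vertex; all order axioms are obtained from it in this way.\<close>

lemma le_rec:
  assumes T: "inc_tree T"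
  shows "le T a x \<longleftrightarrow> x \<in> fst T \<and> (a = x \<or> x \<noteq> Min (fst T) \<and> le T a (snd T x))"
proof (cases "x \<in> fst T \<and> x \<noteq> Min (fst T)")
  case True
  then have "snd T x \<in> fst T" using inc_treeD(4)[OF T] by blast
  then show ?thesis using True anc_rec[of "snd T" a x] unfolding le_def by blast
next
  case False
  then have "snd T x = 0" "snd T 0 = 0" using inc_treeD(3,5)[OF T] by auto
  then show ?thesis
    using False anc_rec[of "snd T" a x] anc_zero[of "snd T" a] inc_treeD(3)[OF T]
    unfolding le_def by metis
qed

lemma inc_tree_order:
  assumes T: "inc_tree T"
  shows "inc_order (fst T) (le T)"
proof -
  note rec = le_rec[OF T] and D = inc_treeD[OF T]
  have D4: "snd T x < x" if "x \<in> fst T" "x \<noteq> Min (fst T)" for x using D(4) that by blast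
  have bound: "le T a x \<Longrightarrow> a \<le> x" for a x
  proof (induction x rule: less_induct)
    case (less x)
    then show ?case using rec[of a x] D4[of x] by fastforce
  qed
  have dom: "le T a x \<Longrightarrow> a \<in> fst T \<and> x \<in> fst T \<and> a \<le> x" for a x
    using bound unfolding le_def by blast
  have trans: "le T x y \<Longrightarrow> le T a x \<Longrightarrow> le T a y" for a x y
  proof (induction y rule: less_induct)
    case (less y)
    then show ?case using rec[of x y] rec[of a y] D4[of y] by blast
  qed
  have lin: "le T a x \<Longrightarrow> le T b x \<Longrightarrow> a \<le> b \<Longrightarrow> le T a b" for a b x
  proof (induction x rule: less_induct)
    case (less x)
    show ?case
    proof (cases "b = x")
      case False
      then have b: "x \<in> fst T" "x \<noteq> Min (fst T)" "le T b (snd T x)" using rec[of b x] less.prems by auto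
      then have "snd T x < x" "b \<le> snd T x" using D4 bound by auto
      then have "a \<noteq> x" using less.prems by auto
      then have "le T a (snd T x)" using rec[of a x] less.prems by auto
      then show ?thesis using less.IH b \<open>snd T x < x\<close> less.prems by blast
    qed (use less in auto)
  qed
  have root: "x \<in> fst T \<Longrightarrow> le T (Min (fst T)) x" for x
  proof (induction x rule: less_induct)
    case (less x)
    then show ?case using rec[of "Min (fst T)" x] D(4)[of x] by blast
  qed
  have refl: "x \<in> fst T \<Longrightarrow> le T x x" for x using rec[of x x] by blast
  show ?thesis
  proof
    show "le T a y" if "le T a x" "le T x y" for a x y using trans that by blast
  qed (fact D(1-3) dom lin refl root)+
qed

context inc_order
begin

lemma finite_below: "finite {a. R a x}"
  by (rule finite_subset[OF _ fin]) (use dom in blast)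

lemma parent_in:
  assumes "x \<in> V" "x \<noteq> Min V"
  shows "R (Max {a. R a x \<and> a < x}) x" "Max {a. R a x \<and> a < x} < x"
proof -
  have "Min V < x" using assms Min_le[OF fin] by (metis le_neq_implies_less)
  then have "Min V \<in> {a. R a x \<and> a < x}" using root assms by auto
  then have "Max {a. R a x \<and> a < x} \<in> {a. R a x \<and> a < x}"
    by (intro Max_in) (auto intro: finite_subset[OF _ finite_below[of x]])
  then show "R (Max {a. R a x \<and> a < x}) x" "Max {a. R a x \<and> a < x} < x" by auto
qed

lemma parent_ge: "R a x \<Longrightarrow> a < x \<Longrightarrow> a \<le> Max {a. R a x \<and> a < x}"
  by (intro Max_ge) (auto intro: finite_subset[OF _ finite_below[of x]])

text \<open>This is the recursion of \<open>le_rec\<close> with the largest proper ancestor in the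
  role of the parent; comparing the two identifies an abstract order with that of the tree built
  from it.\<close>

lemma parent_rec:
  "R a x \<longleftrightarrow> x \<in> V \<and> (a = x \<or> x \<noteq> Min V \<and> R a (Max {a. R a x \<and> a < x}))"
proof
  assume a: "R a x"
  show "x \<in> V \<and> (a = x \<or> x \<noteq> Min V \<and> R a (Max {a. R a x \<and> a < x}))"
  proof (cases "a = x")
    case False
    then have "a < x" "x \<in> V" "a \<in> V" using dom[OF a] by auto
    then have "x \<noteq> Min V" using Min_le[OF fin] by fastforce
    then show ?thesis
      using lin[OF a parent_in(1)[of x] parent_ge] \<open>x \<in> V\<close> \<open>a < x\<close> a by blast
  qed (use dom[OF a] in auto)
qed (use refl trans parent_in in blast)

text \<open>The parent function is described pointwise so that the lemma applies directly to
  \<open>chain_par\<close> and to the parent function of \<open>spl\<close>.\<close>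

lemma tree_of_order:
  assumes p: "\<And>x. p x = (if x \<in> V \<and> x \<noteq> Min V then Max {a. R a x \<and> a < x} else 0)"
  shows "inc_tree (V, p)" "le (V, p) = R"
proof -
  show T: "inc_tree (V, p)"
    unfolding inc_tree_def using fin ne pos parent_in dom by (auto simp: p)
  have "le (V, p) a x = R a x" for a x
  proof (induction x rule: less_induct)
    case (less x)
    then show ?case using le_rec[OF T, of a x] parent_rec[of a x] p[of x] parent_in[of x] by auto
  qed
  then show "le (V, p) = R" by blast
qed

lemma ex_tree: "\<exists>T. inc_tree T \<and> fst T = V \<and> le T = R"
proof (intro exI conjI)
  let ?p = "\<lambda>x. if x \<in> V \<and> x \<noteq> Min V then Max {a. R a x \<and> a < x} else 0"
  show "inc_tree (V, ?p)" "le (V, ?p) = R" by (rule tree_of_order, rule HOL.refl)+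
qed simp

text \<open>Both \<open>a\<close> and \<open>b\<close> lie on the chain to \<open>x\<close>, so the
  smaller is an ancestor of the larger and of everything below it.\<close>

lemma common_below: "R a x \<Longrightarrow> R b x \<Longrightarrow> R a y \<Longrightarrow> R b z \<Longrightarrow> R (min a b) y \<and> R (min a b) z"
  using lin[of a x b] lin[of b x a] trans[of a b z] trans[of b a y]
  by (cases "a \<le> b") (auto simp: min_def)

end

lemma snd_eq_parent:
  assumes T: "inc_tree T"
  shows "snd T x = (if x \<in> fst T \<and> x \<noteq> Min (fst T) then Max {a. le T a x \<and> a < x} else 0)"
proof (cases "x \<in> fst T \<and> x \<noteq> Min (fst T)")
  case True
  interpret inc_order "fst T" "le T" by (rule inc_tree_order[OF T])
  have 1: "snd T x \<in> fst T" "snd T x < x" using inc_treeD(4)[OF T] True by auto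
  have "Max {a. le T a x \<and> a < x} = snd T x"
  proof (rule Max_eqI)
    show "finite {a. le T a x \<and> a < x}" by (rule finite_subset[OF _ finite_below[of x]]) auto
    show "snd T x \<in> {a. le T a x \<and> a < x}" using 1 True le_rec[OF T, of "snd T x" x] refl[of "snd T x"] by auto
    show "y \<le> snd T x" if "y \<in> {a. le T a x \<and> a < x}" for y
      using that le_rec[OF T, of y x] dom[of y "snd T x"] by auto
  qed
  then show ?thesis using True by simp
next
  case False
  then show ?thesis using inc_treeD(5)[OF T, of x] by auto
qed

text \<open>The parent is recovered from the order as the largest proper ancestor, and the
  normalisation to \<open>0\<close> fixes the parent function elsewhere.\<close>

lemma inc_tree_eqI:
  assumes "inc_tree T" "inc_tree T'" "fst T = fst T'" "le T = le T'"
  shows "T = T'"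
proof (rule prod_eqI)
  show "snd T = snd T'"
    by (rule ext) (simp only: snd_eq_parent[OF assms(1)] snd_eq_parent[OF assms(2)] assms(3,4))
qed (rule assms(3))

lemma chain_tree_order:
  assumes "finite S" "S \<noteq> {}" "0 \<notin> S"
  shows "inc_tree (chain_tree S)" "le (chain_tree S) = (\<lambda>a x. a \<in> S \<and> x \<in> S \<and> a \<le> x)"
proof -
  interpret inc_order S "\<lambda>a x. a \<in> S \<and> x \<in> S \<and> a \<le> x"
    by unfold_locales (use assms in auto)
  have "chain_par S x =
      (if x \<in> S \<and> x \<noteq> Min S then Max {a. (a \<in> S \<and> x \<in> S \<and> a \<le> x) \<and> a < x} else 0)" for x
    unfolding chain_par_def by (auto intro!: arg_cong[where f = Max])
  from tree_of_order[OF this]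
  show "inc_tree (chain_tree S)" "le (chain_tree S) = (\<lambda>a x. a \<in> S \<and> x \<in> S \<and> a \<le> x)"
    unfolding chain_tree_def by auto
qed

section \<open>Splicing\<close>

text \<open>A vertex \<open>a\<close> of one tree becomes an ancestor of \<open>x\<close> in the
  other exactly if \<open>a\<close> is on its own distinguished chain and \<open>x\<close> leaves
  the merged chain after \<open>a\<close>. The witness \<open>b\<close> is a vertex of the other
  chain that is above \<open>x\<close> and comes after \<open>a\<close>.\<close>

definition splice_order ::
  "(nat \<Rightarrow> nat \<Rightarrow> bool) \<Rightarrow> nat \<Rightarrow> (nat \<Rightarrow> nat \<Rightarrow> bool) \<Rightarrow> nat \<Rightarrow> nat \<Rightarrow> nat \<Rightarrow> bool" where
  "splice_order R1 v1 R2 v2 a x \<longleftrightarrow> R1 a x \<or> R2 a x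
    \<or> R2 a v2 \<and> (\<exists>b. R1 b v1 \<and> R1 b x \<and> a < b)
    \<or> R1 a v1 \<and> (\<exists>b. R2 b v2 \<and> R2 b x \<and> a < b)"

lemma splice_order_commute: "splice_order R1 v1 R2 v2 = splice_order R2 v2 R1 v1"
  unfolding splice_order_def by (intro ext) blast

locale splice_orders = A: inc_order V1 R1 + B: inc_order V2 R2
  for V1 R1 V2 R2 +
  fixes v1 v2 :: nat
  assumes disj: "V1 \<inter> V2 = {}" and v1: "v1 \<in> V1" and v2: "v2 \<in> V2"
begin

abbreviation "R \<equiv> splice_order R1 v1 R2 v2"

lemma not_both: "x \<in> V1 \<Longrightarrow> x \<notin> V2"
  using disj by blast

text \<open>By this symmetry \<open>R_trans1\<close>, \<open>R_lin1\<close> and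
  \<open>R_root1\<close> need only treat a lowest vertex in \<open>V1\<close>; the swapped instance
  gives the rest.\<close>

lemma splice_orders_commute: "splice_orders V2 R2 V1 R1 v2 v1"
  by unfold_locales (use disj v1 v2 in auto)

lemma R11: "a \<in> V1 \<Longrightarrow> x \<in> V1 \<Longrightarrow> R a x \<longleftrightarrow> R1 a x"
  unfolding splice_order_def using A.dom B.dom not_both by metis

lemma R22: "a \<in> V2 \<Longrightarrow> x \<in> V2 \<Longrightarrow> R a x \<longleftrightarrow> R2 a x"
  unfolding splice_order_def using A.dom B.dom not_both by metis

lemma R21: "a \<in> V2 \<Longrightarrow> x \<in> V1 \<Longrightarrow> R a x \<longleftrightarrow> R2 a v2 \<and> (\<exists>b. R1 b v1 \<and> R1 b x \<and> a < b)"
  unfolding splice_order_def using A.dom B.dom not_both by metis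

lemma R12: "a \<in> V1 \<Longrightarrow> x \<in> V2 \<Longrightarrow> R a x \<longleftrightarrow> R1 a v1 \<and> (\<exists>b. R2 b v2 \<and> R2 b x \<and> a < b)"
  unfolding splice_order_def using A.dom B.dom not_both by metis

lemma R_dom: "R a x \<Longrightarrow> a \<in> V1 \<union> V2 \<and> x \<in> V1 \<union> V2 \<and> a \<le> x"
  unfolding splice_order_def using A.dom B.dom by (meson UnI1 UnI2 less_imp_le le_trans)

lemma R_trans1:
  assumes "R a x" "R x y" "y \<in> V1"
  shows "R a y"
proof -
  consider "a \<in> V1" "x \<in> V1" | "a \<in> V2" "x \<in> V1" | "a \<in> V1" "x \<in> V2" | "a \<in> V2" "x \<in> V2"
    using R_dom assms by blast
  then show ?thesis
  proof cases
    case 1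
    then show ?thesis using assms R11 A.trans by metis
  next
    case 2
    then show ?thesis using assms R11 R21 A.trans by metis
  next
    \<comment> \<open>The path passes from \<open>V1\<close> to \<open>V2\<close> and back. As
      \<open>a < x < b\<close> and both \<open>a\<close> and \<open>b\<close> are on the chain to
      \<open>v1\<close>, \<open>a\<close> is an ancestor of \<open>b\<close>.\<close>
    case 3
    then obtain b where b: "R1 b v1" "R1 b y" "x < b" using assms R21 by blast
    have "R1 a v1" "a < b" using 3 assms R12 B.dom R_dom b by (metis, fastforce)
    then have "R1 a b" using A.lin b by (metis less_imp_le)
    then show ?thesis using A.trans b R11 3 assms by metis
  next
    case 4
    then obtain b where b: "R1 b v1" "R1 b y" "x < b" "R2 x v2" using assms R21 by blast
    have "R2 a x" using 4 assms R22 by blast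
    then have "a < b" "R2 a v2" using b B.dom B.trans by (fastforce, metis)
    then show ?thesis using R21 4 assms b by blast
  qed
qed

lemma R_lin1:
  assumes "R a x" "R b x" "a \<le> b" "x \<in> V1"
  shows "R a b"
proof -
  consider "a \<in> V1" "b \<in> V1" | "a \<in> V2" "b \<in> V1" | "a \<in> V1" "b \<in> V2" | "a \<in> V2" "b \<in> V2"
    using R_dom assms by blast
  then show ?thesis
  proof cases
    case 1
    then show ?thesis using assms R11 A.lin by metis
  next
    case 2
    then obtain c where c: "R2 a v2" "R1 c v1" "R1 c x" "a < c" using assms R21 by blast
    have b: "R1 b x" using 2 assms R11 by blast
    have "a < b" using 2 assms not_both by (metis le_neq_implies_less)
    \<comment> \<open>Both \<open>b\<close> and \<open>c\<close> are ancestors of \<open>x\<close>.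
      The smaller is an ancestor of both \<open>b\<close> and \<open>v1\<close> and still exceeds
      \<open>a\<close>, so it is the witness required by \<open>R21\<close>.\<close>
    have "R1 (min b c) b \<and> R1 (min b c) v1"
      using A.common_below[OF b c(3), of b v1] c b A.refl 2 by blast
    then show ?thesis using R21 2 c \<open>a < b\<close> by (metis min_less_iff_conj)
  next
    case 3
    then obtain c where c: "R2 b v2" "R1 c v1" "R1 c x" "b < c" using assms R21 by blast
    have "R1 a x" using 3 assms R11 by blast
    then have "R1 a c" using A.lin c assms by (metis le_trans less_imp_le)
    then have "R1 a v1" using A.trans c by blast
    moreover have "a < b" using 3 assms not_both by (metis le_neq_implies_less)
    ultimately show ?thesis using R12 3 c B.refl by blast
  next
    case 4
    then show ?thesis using assms R21 R22 B.lin by metis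
  qed
qed

lemma R_root1:
  assumes "x \<in> V1"
  shows "R (Min (V1 \<union> V2)) x"
proof (cases "Min V1 \<le> Min V2")
  case True
  then have "Min (V1 \<union> V2) = Min V1"
    using Min_Un[OF A.fin A.ne B.fin B.ne] by (simp add: min_def)
  then show ?thesis using A.root[OF assms] R11 A.dom by metis
next
  case False
  then have "Min (V1 \<union> V2) = Min V2"
    using Min_Un[OF A.fin A.ne B.fin B.ne] by (simp add: min_def)
  moreover have "R (Min V2) x"
    using R21[of "Min V2" x] assms False A.root[OF assms] A.root[OF v1] B.root[OF v2] B.dom
    by (metis not_le)
  ultimately show ?thesis by simp
qed

end

sublocale splice_orders \<subseteq> inc_order "V1 \<union> V2" "splice_order R1 v1 R2 v2"
proof -
  interpret C: splice_orders V2 R2 V1 R1 v2 v1 by (rule splice_orders_commute)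
  note com = splice_order_commute[of R2 v2 R1 v1] Un_commute[of V2 V1]
  note C_facts = C.R_trans1[unfolded com] C.R_lin1[unfolded com] C.R_root1[unfolded com]
  show "inc_order (V1 \<union> V2) R"
  proof
    show "finite (V1 \<union> V2)" "V1 \<union> V2 \<noteq> {}" "0 \<notin> V1 \<union> V2"
      using A.fin B.fin A.ne A.pos B.pos by auto
    show "R a x \<Longrightarrow> a \<in> V1 \<union> V2 \<and> x \<in> V1 \<union> V2 \<and> a \<le> x" for a x by (rule R_dom)
    show "x \<in> V1 \<union> V2 \<Longrightarrow> R x x" for x using R11 R22 A.refl B.refl by blast
    show "R a x \<Longrightarrow> R x y \<Longrightarrow> R a y" for a x y
      using R_trans1 C_facts(1) R_dom by blast
    show "R a x \<Longrightarrow> R b x \<Longrightarrow> a \<le> b \<Longrightarrow> R a b" for a x b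
      using R_lin1 C_facts(2) R_dom by blast
    show "x \<in> V1 \<union> V2 \<Longrightarrow> R (Min (V1 \<union> V2)) x" for x
      using R_root1 C_facts(3) by blast
  qed
qed

section \<open>The splice of trees realises the spliced order\<close>

lemma spl_order:
  assumes T1: "inc_tree T1" and T2: "inc_tree T2" and disj: "fst T1 \<inter> fst T2 = {}"
    and v1: "v1 \<in> fst T1" and v2: "v2 \<in> fst T2"
  shows "inc_tree (spl T1 v1 T2 v2)" "le (spl T1 v1 T2 v2) = splice_order (le T1) v1 (le T2) v2"
    "fst (spl T1 v1 T2 v2) = fst T1 \<union> fst T2"
proof -
  interpret splice_orders "fst T1" "le T1" "fst T2" "le T2" v1 v2
    by (intro splice_orders.intro splice_orders_axioms.intro inc_tree_order assms)
  define C where "C = chain_to T1 v1 \<union> chain_to T2 v2"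
  define V where "V = fst T1 \<union> fst T2"
  have C: "a \<in> C \<longleftrightarrow> le T1 a v1 \<or> le T2 a v2" for a
    using v1 v2 unfolding C_def chain_to_def le_def by auto
  have CV: "C \<subseteq> V" using C A.dom B.dom unfolding V_def by blast
  \<comment> \<open>On the merged chain the spliced order is the order of the integers, which is
    what \<open>chain_par\<close> encodes.\<close>
  have Cle: "R a u \<longleftrightarrow> a \<in> C \<and> a \<le> u" if u: "u \<in> C" for a u
  proof (cases "u \<in> fst T1")
    case True
    then have u1: "le T1 u v1" using u C B.dom not_both by blast
    have "a \<in> fst T1 \<Longrightarrow> ?thesis"
      using R11[of a u] A.trans[OF _ u1] A.lin[OF _ u1] True A.dom[of a u] B.dom[of a v2] C[of a]
        not_both[of a] by blast
    moreover have "a \<in> fst T2 \<Longrightarrow> ?thesis"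
      using R21[of a u] True u1 A.dom[of a v1] A.dom[of _ u] C[of a] not_both[of a] A.refl[OF True]
        R_dom[of a u] not_both[OF True]
      by (metis le_neq_implies_less)
    ultimately show ?thesis using R_dom[of a u] CV unfolding V_def by blast
  next
    case False
    then have u1: "le T2 u v2" using u C A.dom by blast
    then have u2: "u \<in> fst T2" using B.dom by blast
    have "a \<in> fst T2 \<Longrightarrow> ?thesis"
      using R22[of a u] B.trans[OF _ u1] B.lin[OF _ u1] u2 B.dom[of a u] A.dom[of a v1] C[of a]
        not_both[of a] by blast
    moreover have "a \<in> fst T1 \<Longrightarrow> ?thesis"
      using R12[of a u] u2 u1 B.dom[of a v2] C[of a] not_both[of a] B.refl[OF u2] R_dom[of a u] False
      by (metis le_neq_implies_less)
    ultimately show ?thesis using R_dom[of a u] CV unfolding V_def by blast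
  qed
  define p where "p = (\<lambda>u. if u \<in> C then chain_par C u
          else if u \<in> fst T1 then snd T1 u else if u \<in> fst T2 then snd T2 u else 0)"
  have finC: "finite C" using finite_subset[OF CV] fin unfolding V_def by blast
  have minC: "Min C = Min V"
  proof (rule Min_eqI)
    show "finite C" by (rule finC)
    show "Min V \<in> C" using Cle[of v1 "Min V"] root[of v1] v1 A.refl[OF v1] C unfolding V_def by blast
    show "\<And>y. y \<in> C \<Longrightarrow> Min V \<le> y" using CV Min_le[OF fin] unfolding V_def by blast
  qed
  \<comment> \<open>A vertex off the merged chain keeps its parent: an ancestor from the other tree
    is smaller than some chain vertex \<open>b\<close> above \<open>x\<close>, and \<open>b\<close>
    is at most the parent of \<open>x\<close>. The trees are universally quantified so that the fact
    can be used for either one.\<close>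
  have other: "snd T1 x = Max {a. R a x \<and> a < x} \<and> x \<noteq> Min V" if x: "x \<in> fst T1" "x \<notin> C"
    and sp: "splice_orders (fst T1) (le T1) (fst T2) (le T2) v1 v2"
    and C: "\<And>a. a \<in> C \<longleftrightarrow> le T1 a v1 \<or> le T2 a v2" and R: "R = splice_order (le T1) v1 (le T2) v2"
    and T1: "inc_tree T1" for x T1 T2 v1 v2 R
  proof -
    interpret S: splice_orders "fst T1" "le T1" "fst T2" "le T2" v1 v2 by fact
    have nm: "x \<noteq> Min (fst T1)" using x C S.A.root S.v1 by blast
    have p: "snd T1 x \<in> fst T1" "snd T1 x < x" using inc_treeD(4)[OF T1] nm x by auto
    have "Max {a. R a x \<and> a < x} = snd T1 x"
    proof (rule Max_eqI)
      show "finite {a. R a x \<and> a < x}" by (rule finite_subset[of _ "{..<x}"]) auto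
      show "snd T1 x \<in> {a. R a x \<and> a < x}" using p x nm le_rec[OF T1, of "snd T1 x" x] S.A.refl[of "snd T1 x"] S.R11[of "snd T1 x" x] R by auto
      show "y \<le> snd T1 x" if y: "y \<in> {a. R a x \<and> a < x}" for y
      proof (cases "y \<in> fst T1")
        case True
        then have "le T1 y x" using y S.R11 x R by blast
        then show ?thesis using le_rec[OF T1, of y x] y S.A.dom[of y "snd T1 x"] by auto
      next
        case False
        then have "y \<in> fst T2" using y S.R_dom R by blast
        then obtain b where b: "le T1 b v1" "le T1 b x" "y < b" using S.R21 y x R by blast
        then have "b \<noteq> x" using x C by auto
        then have "b \<le> snd T1 x" using le_rec[OF T1, of b x] b S.A.dom[of b "snd T1 x"] by auto
        then show ?thesis using b by simp
      qed
    qed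
    moreover have "x \<noteq> Min V" using x minC
      using Min_in[OF finC] C S.A.refl[OF S.v1] by (metis empty_iff)
    ultimately show ?thesis by simp
  qed
  have p: "p x = (if x \<in> V \<and> x \<noteq> Min V then Max {a. R a x \<and> a < x} else 0)" for x
  proof -
    consider "x \<in> C" | "x \<notin> C" "x \<in> fst T1" | "x \<notin> C" "x \<in> fst T2" | "x \<notin> V"
      unfolding V_def by blast
    then show ?thesis
    proof cases
      case 1
      then have "{a \<in> C. a < x} = {a. R a x \<and> a < x}" using Cle by auto
      then show ?thesis using 1 CV minC unfolding p_def chain_par_def by auto
    next
      case 2
      have "snd T1 x = Max {a. R a x \<and> a < x} \<and> x \<noteq> Min V"
        by (rule other[OF 2(2,1) splice_orders_axioms C _ T1]) simp
      then show ?thesis using 2 unfolding p_def V_def by auto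
    next
      case 3
      have "snd T2 x = Max {a. R a x \<and> a < x} \<and> x \<noteq> Min V"
        by (rule other[OF 3(2,1) splice_orders_commute _ splice_order_commute T2]) (use C in auto)
      then show ?thesis using 3 not_both unfolding p_def V_def by auto
    next
      case 4
      then show ?thesis using CV unfolding p_def V_def by auto
    qed
  qed
  have "spl T1 v1 T2 v2 = (V, p)"
    unfolding spl_def C_def V_def p_def Let_def by simp
  then show "inc_tree (spl T1 v1 T2 v2)" "le (spl T1 v1 T2 v2) = splice_order (le T1) v1 (le T2) v2"
    "fst (spl T1 v1 T2 v2) = fst T1 \<union> fst T2"
    using tree_of_order[OF p[unfolded V_def]] unfolding V_def by auto
qed

section \<open>Blocks and the class of a vertex\<close>

text \<open>A set partition is given by the map \<open>f\<close> sending each element to the maximum of its block.\<close>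

definition compat :: "(nat \<Rightarrow> nat) \<Rightarrow> nat set \<Rightarrow> (nat \<Rightarrow> nat \<Rightarrow> bool) \<Rightarrow> bool" where
  "compat f V R \<longleftrightarrow> (\<forall>x\<in>V. f x \<in> V \<and> R x (f x))"

text \<open>Equivalently: no block other than that of \<open>m\<close> contains the deepest common
  ancestor of \<open>m\<close> and of its own maximum.\<close>

definition conn :: "(nat \<Rightarrow> nat) \<Rightarrow> (nat \<Rightarrow> nat \<Rightarrow> bool) \<Rightarrow> nat \<Rightarrow> bool" where
  "conn f R m \<longleftrightarrow> (\<forall>x. R x m \<and> f x \<noteq> m \<longrightarrow> (\<exists>a>x. R a (f x) \<and> R a m))"

definition hang :: "(nat \<Rightarrow> nat \<Rightarrow> bool) \<Rightarrow> nat \<Rightarrow> nat \<Rightarrow> nat" where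
  "hang R m y = Max {a. R a y \<and> R a m}"

text \<open>The rule follows \<open>hang R m \<circ> f\<close> backwards from \<open>m\<close>, so
  the set collects the vertices whose orbit reaches \<open>m\<close>.\<close>

inductive_set main_class :: "nat set \<Rightarrow> (nat \<Rightarrow> nat) \<Rightarrow> (nat \<Rightarrow> nat \<Rightarrow> bool) \<Rightarrow> nat \<Rightarrow> nat set"
  for V f R m where
  base: "m \<in> main_class V f R m"
| step: "x \<in> V \<Longrightarrow> hang R m (f x) \<in> main_class V f R m \<Longrightarrow> x \<in> main_class V f R m"

definition restr :: "(nat \<Rightarrow> nat \<Rightarrow> bool) \<Rightarrow> nat set \<Rightarrow> nat \<Rightarrow> nat \<Rightarrow> bool" where
  "restr R U a x \<longleftrightarrow> a \<in> U \<and> x \<in> U \<and> R a x"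

section \<open>Splitting off the class of a block maximum\<close>

locale block_order = inc_order +
  fixes f :: "nat \<Rightarrow> nat" and m :: nat
  assumes comp: "compat f V R" and idem: "\<And>x. f (f x) = f x"
    and m: "m \<in> V" and fm: "f m = m"
begin

abbreviation "h \<equiv> hang R m"
abbreviation "W \<equiv> main_class V f R m"

lemma f: "x \<in> V \<Longrightarrow> f x \<in> V" "x \<in> V \<Longrightarrow> R x (f x)"
  using comp unfolding compat_def by auto

lemma h:
  assumes "y \<in> V"
  shows "R (h y) y" "R (h y) m" "h y \<in> V"
proof -
  have "h y \<in> {a. R a y \<and> R a m}" unfolding hang_def
  proof (rule Max_in)
    show "finite {a. R a y \<and> R a m}" by (rule finite_subset[OF _ finite_below[of y]]) auto
    show "{a. R a y \<and> R a m} \<noteq> {}" using root[OF assms] root[OF m] by blast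
  qed
  then show "R (h y) y" "R (h y) m" "h y \<in> V" using dom by auto
qed

lemma h_ge: "R a y \<Longrightarrow> R a m \<Longrightarrow> a \<le> h y"
  unfolding hang_def
  by (rule Max_ge) (auto intro: finite_subset[OF _ finite_below[of y]])

lemma h_chain: "R x m \<Longrightarrow> h x = x"
  by (metis antisym dom h(1) h_ge refl)

text \<open>The path to \<open>y\<close> has already left the chain to \<open>m\<close> when it
  reaches \<open>x\<close>, so both vertices hang from the same chain vertex.\<close>

lemma h_off_chain:
  assumes "R x y" "\<not> R x m"
  shows "h x = h y"
proof -
  have "x \<in> V" "y \<in> V" using dom assms by auto
  then have "h x \<le> h y" using h_ge h trans assms by blast
  moreover have "h y \<le> x"
    using lin[OF assms(1) h(1)] h(2) trans assms \<open>y \<in> V\<close> by (meson nat_le_linear)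
  then have "h y \<le> h x" using lin[OF h(1) assms(1)] h h_ge \<open>y \<in> V\<close> by blast
  ultimately show ?thesis by simp
qed

lemma W_sub: "W \<subseteq> V"
proof
  show "x \<in> W \<Longrightarrow> x \<in> V" for x by (induction rule: main_class.induct) (use m in auto)
qed

lemma W_iff: "x \<in> V \<Longrightarrow> x \<in> W \<longleftrightarrow> h (f x) \<in> W"
proof
  assume "x \<in> W"
  then show "h (f x) \<in> W"
    by (cases rule: main_class.cases) (use fm h_chain refl m main_class.base in auto)
qed (rule main_class.step)

lemma W_f: "x \<in> V \<Longrightarrow> f x \<in> W \<longleftrightarrow> x \<in> W"
  using W_iff[of x] W_iff[of "f x"] f idem by auto

text \<open>On the chain \<open>h x = x\<close>; off it \<open>h x = h (f x)\<close>, since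
  \<open>x\<close> is an ancestor of \<open>f x\<close>. So membership in the class is decided at
  the chain vertex from which \<open>x\<close> hangs.\<close>

lemma W_h: "x \<in> V \<Longrightarrow> h x \<in> W \<longleftrightarrow> x \<in> W"
  using W_iff[of x] h_chain[of x] h_off_chain[of x "f x"] f by (cases "R x m") auto

text \<open>If a fixed point enters by the rule \<open>step\<close>, it is its own premise, and the
  induction hypothesis applies to it.\<close>

lemma W_fixed: "x \<in> W \<Longrightarrow> h (f x) = x \<Longrightarrow> x = m"
  by (induction rule: main_class.induct) auto

text \<open>A chain vertex \<open>x\<close> of the class with \<open>f x \<noteq> m\<close> is no
  fixed point, by \<open>W_fixed\<close>; hence \<open>h (f x)\<close> lies strictly deeper and is
  the required witness.\<close>

lemma W_conn: "conn f (restr R W) m"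
  unfolding conn_def
proof (intro allI impI)
  fix x assume "restr R W x m \<and> f x \<noteq> m"
  then have x: "x \<in> W" "x \<in> V" "R x m" "f x \<noteq> m" unfolding restr_def using W_sub by auto
  have "x \<noteq> h (f x)" using W_fixed[of x] x fm by metis
  then have "x < h (f x)" using h_ge[of x "f x"] x f by auto
  moreover have "h (f x) \<in> W" "f x \<in> W" "m \<in> W" using x W_iff W_f main_class.base by auto
  ultimately show "\<exists>a>x. restr R W a (f x) \<and> restr R W a m"
    unfolding restr_def using h f x by blast
qed

text \<open>The vertex \<open>d\<close> where the chains to \<open>n\<close> and \<open>m\<close>
  part is a fixed point of \<open>h \<circ> f\<close> other than \<open>m\<close>. Indeed, for
  \<open>f d \<noteq> n\<close>, \<open>conn\<close> provides a deeper common ancestor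
  \<open>a\<close> of \<open>f d\<close> and \<open>n\<close>; were \<open>h (f d)\<close> also
  deeper than \<open>d\<close>, the smaller of the two would lie on both chains beyond
  \<open>d\<close>.\<close>

lemma other_main_notin:
  assumes "conn f R n" "n \<in> V" "f n = n" "n \<noteq> m"
  shows "n \<notin> W"
proof -
  have c: "\<exists>a>x. R a (f x) \<and> R a n" if "R x n" "f x \<noteq> n" for x
    using assms(1) that unfolding conn_def by blast
  define d where "d = h n"
  have d: "R d n" "R d m" "d \<in> V" using h assms unfolding d_def by auto
  have "h (f d) = d"
  proof (cases "f d = n")
    case False
    then obtain a where a: "a > d" "R a (f d)" "R a n" using c d by blast
    have "R d (f d)" using f d by auto
    then have "d \<le> h (f d)" using h_ge d by auto
    moreover have "h (f d) \<le> d"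
    proof (rule ccontr)
      assume *: "\<not> h (f d) \<le> d"
      have "f d \<in> V" using f d by auto
      then have "R (min a (h (f d))) n \<and> R (min a (h (f d))) m"
        using common_below[OF a(2) h(1) a(3) h(2)] by blast
      then have "min a (h (f d)) \<le> d" using h_ge unfolding d_def by blast
      then show False using a * by auto
    qed
    ultimately show ?thesis by simp
  qed (use d_def in simp)
  \<comment> \<open>For \<open>d = m\<close>, \<open>conn\<close> would give an ancestor of
    \<open>f m = m\<close> larger than \<open>m\<close>.\<close>
  moreover have "d \<noteq> m"
  proof
    assume "d = m"
    then obtain a where "a > m" "R a m" using c[of m] d fm assms by auto
    then show False using dom by fastforce
  qed
  ultimately have "d \<notin> W" using W_fixed by blast
  then show ?thesis using W_h assms d_def by auto
qed

lemma min_notin: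
  assumes "f (Min V) = Min V" "Min V \<noteq> m"
  shows "Min V \<notin> W"
  using W_fixed[of "Min V"] h_chain[OF root[OF m]] assms by auto

text \<open>Only the root axiom needs an argument. The least element of \<open>U\<close> hangs from
  an element of \<open>U\<close>, hence from itself, so it is on the chain to \<open>m\<close>;
  every other \<open>x\<close> in \<open>U\<close> hangs from a chain vertex in \<open>U\<close>,
  which lies below it.\<close>

lemma restr_order:
  assumes U: "U \<subseteq> V" "U \<noteq> {}" "\<And>x. x \<in> V \<Longrightarrow> h x \<in> U \<longleftrightarrow> x \<in> U"
  shows "inc_order U (restr R U)"
proof
  show fU: "finite U" using U fin finite_subset by auto
  show "U \<noteq> {}" "0 \<notin> U" using U pos by auto
  show "restr R U a x \<Longrightarrow> a \<in> U \<and> x \<in> U \<and> a \<le> x" for a x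
    unfolding restr_def using dom by blast
  show "x \<in> U \<Longrightarrow> restr R U x x" for x unfolding restr_def using refl U by blast
  show "restr R U a x \<Longrightarrow> restr R U x y \<Longrightarrow> restr R U a y" for a x y
    unfolding restr_def using trans by blast
  show "restr R U a x \<Longrightarrow> restr R U b x \<Longrightarrow> a \<le> b \<Longrightarrow> restr R U a b" for a b x
    unfolding restr_def using lin by blast
  have mU: "Min U \<in> U" "Min U \<in> V" using fU U Min_in by auto
  then have "h (Min U) = Min U"
    using U(3) Min_le[OF fU] dom h(1) by (meson antisym)
  then have mm: "R (Min U) m" using h(2) mU by metis
  fix x assume x: "x \<in> U"
  then have "x \<in> V" "h x \<in> U" using U by auto
  then have "R (Min U) (h x)" using lin[OF mm h(2)] Min_le[OF fU] by auto
  then show "restr R U (Min U) x" unfolding restr_def using mU x h(1) trans \<open>x \<in> V\<close> by blast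
qed

text \<open>This undoes a splice at the level of orders. As \<open>v2\<close> is the last chain
  vertex outside the class, the chain to \<open>m\<close> consists of the chain to \<open>m\<close>
  within the class and the chain to \<open>v2\<close> within the complement.\<close>

lemma split:
  assumes n: "n \<in> V" "n \<notin> W"
  defines "v2 \<equiv> Max {a \<in> V - W. R a m}"
  shows "inc_order W (restr R W)" "inc_order (V - W) (restr R (V - W))"
    "v2 \<in> V - W" "v2 < m" "R = splice_order (restr R W) m (restr R (V - W)) v2"
proof -
  show 1: "inc_order W (restr R W)" by (rule restr_order) (use W_sub main_class.base[of m V f R] W_h in blast)+
  show 2: "inc_order (V - W) (restr R (V - W))" by (rule restr_order) (use n W_h h in auto)
  have fC: "finite {a \<in> V - W. R a m}" using fin by auto
  have hC: "h x \<in> {a \<in> V - W. R a m}" if "x \<in> V - W" for x using that h W_h by auto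
  have v2: "v2 \<in> {a \<in> V - W. R a m}" unfolding v2_def
    by (rule Max_in[OF fC]) (use hC n in blast)
  then show v2': "v2 \<in> V - W" by blast
  show v2m: "v2 < m" using v2 dom[of v2 m] main_class.base[of m V f R] by (metis (no_types, lifting) DiffE le_neq_implies_less mem_Collect_eq)
  have Rv2: "R a v2" if "a \<in> V - W" "R a m" for a
    using lin[of a m v2] that v2 Max_ge[OF fC] unfolding v2_def by auto
  interpret S: splice_orders W "restr R W" "V - W" "restr R (V - W)" m v2
    by (intro splice_orders.intro splice_orders_axioms.intro 1 2 main_class.base v2') auto
  \<comment> \<open>Relations between the two parts occur only along the chain to \<open>m\<close>:
    off it, \<open>a\<close> and \<open>x\<close> would hang from the same vertex and belong to the
    same part. The vertex \<open>h x\<close> later serves as the witness in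
    \<open>splice_order\<close>.\<close>
  have cross: "R a m \<and> a < h x" if "R a x" "a \<in> W \<longleftrightarrow> x \<notin> W" for a x
  proof -
    have V: "a \<in> V" "x \<in> V" using dom that by auto
    have "R a m" using h_off_chain[OF that(1)] W_h V that(2) by metis
    moreover have "a \<le> h x" using h_ge that calculation by blast
    moreover have "a \<noteq> h x" using W_h V that by metis
    ultimately show ?thesis by auto
  qed
  have "R a x \<longleftrightarrow> S.R a x" for a x
  proof -
    consider "a \<in> W" "x \<in> W" | "a \<in> V - W" "x \<in> V - W" | "a \<in> V - W" "x \<in> W"
      | "a \<in> W" "x \<in> V - W" | "a \<notin> V \<or> x \<notin> V" using W_sub by blast
    then show ?thesis
    proof cases
      case 1
      then show ?thesis using S.R11 unfolding restr_def by auto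
    next
      case 2
      then show ?thesis using S.R22 unfolding restr_def by auto
    next
      case 3
      have x: "x \<in> V" using 3 W_sub by auto
      show ?thesis
      proof
        assume "R a x"
        then have "R a m" "a < h x" using cross 3 by auto
        moreover have "restr R W (h x) m" "restr R W (h x) x"
          using W_h[OF x] h[OF x] 3 main_class.base unfolding restr_def by auto
        moreover have "restr R (V - W) a v2"
          using Rv2[of a] 3 v2' \<open>R a m\<close> unfolding restr_def by auto
        ultimately show "S.R a x" unfolding splice_order_def by blast
      next
        assume "S.R a x"
        then obtain b where "R a v2" "R b m" "R b x" "a < b" using S.R21 3 unfolding restr_def by blast
        then show "R a x" using v2 trans lin by (metis (no_types, lifting) less_imp_le mem_Collect_eq)
      qed
    next
      case 4
      show ?thesis
      proof
        assume "R a x"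
        then have "R a m" "a < h x" using cross 4 by auto
        moreover have hx: "h x \<in> V - W" "R (h x) m" "R (h x) x" using W_h[of x] h[of x] 4 by auto
        then have "restr R (V - W) (h x) v2" "restr R (V - W) (h x) x"
          using Rv2[OF hx(1,2)] 4 v2' unfolding restr_def by auto
        moreover have "restr R W a m"
          using 4 main_class.base \<open>R a m\<close> unfolding restr_def by auto
        ultimately show "S.R a x" unfolding splice_order_def by blast
      next
        assume "S.R a x"
        then obtain b where "R a m" "R b v2" "R b x" "a < b" using S.R12 4 unfolding restr_def by blast
        then show "R a x" using v2 trans lin by (metis (no_types, lifting) less_imp_le mem_Collect_eq)
      qed
    next
      case 5
      then show ?thesis using dom S.R_dom W_sub by blast
    qed
  qed
  then show "R = S.R" by blast
qed

end

section \<open>The class of the maximum in a spliced order\<close>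

locale block_splice = splice_orders +
  fixes f :: "nat \<Rightarrow> nat"
  assumes comp1: "compat f V1 R1" and comp2: "compat f V2 R2" and idem: "\<And>x. f (f x) = f x"
    and fv1: "f v1 = v1" and less: "v2 < v1" and conn1: "conn f R1 v1"
begin

lemma comp: "compat f (V1 \<union> V2) R"
  using comp1 comp2 R11 R22 unfolding compat_def by blast

sublocale block_order "V1 \<union> V2" "splice_order R1 v1 R2 v2" f v1
  by unfold_locales (use comp idem fv1 v1 in auto)

text \<open>Here \<open>v2 < v1\<close> enters: every vertex on the chain to \<open>v2\<close> is
  smaller than \<open>v1\<close>, so \<open>v1\<close> itself is the witness in
  \<open>R21\<close>.\<close>

lemma chain2: "a \<in> V2 \<Longrightarrow> R a v1 \<longleftrightarrow> R2 a v2"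
  using R21[OF _ v1] B.dom less A.refl[OF v1] by (metis order.strict_trans1)

lemma chain1: "a \<in> V1 \<Longrightarrow> R a v1 \<longleftrightarrow> R1 a v1"
  using R11 v1 by blast

lemma f1: "x \<in> V1 \<Longrightarrow> f x \<in> V1 \<and> R1 x (f x)" and f2: "x \<in> V2 \<Longrightarrow> f x \<in> V2 \<and> R2 x (f x)"
  using comp1 comp2 unfolding compat_def by auto

text \<open>If \<open>x\<close> hung from a vertex of the other tree, the witness \<open>c\<close>
  in \<open>R21\<close> would be a deeper common ancestor of \<open>x\<close> and \<open>v1\<close>.
  The same reasoning with \<open>R12\<close> gives \<open>h2\<close>.\<close>

lemma h1: assumes "x \<in> V1" shows "h x \<in> V1"
proof (rule ccontr)
  assume "h x \<notin> V1"
  then have "h x \<in> V2" "R (h x) x" using h assms by auto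
  then obtain c where c: "R1 c v1" "R1 c x" "h x < c" using R21 assms by blast
  then have "R c v1" "R c x" unfolding splice_order_def by auto
  then show False using h_ge c by fastforce
qed

lemma h2: assumes "x \<in> V2" shows "h x \<in> V2"
proof (rule ccontr)
  assume "h x \<notin> V2"
  then have "h x \<in> V1" "R (h x) x" using h assms by auto
  then obtain c where c: "R2 c v2" "R2 c x" "h x < c" using R12 assms by blast
  then have "R c v1" "R c x" using chain2 B.dom unfolding splice_order_def by blast+
  then show False using h_ge c by fastforce
qed

text \<open>The class stays inside \<open>V1\<close> because \<open>V2\<close> is closed under
  \<open>f\<close> and \<open>h\<close>. Conversely, by \<open>conn1\<close> each application of
  \<open>h \<circ> f\<close> moves strictly down the chain to \<open>v1\<close> until it meets the
  block of \<open>v1\<close>; hence the induction on the remaining distance.\<close>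

lemma W_eq: "W = V1"
proof
  show "W \<subseteq> V1"
  proof
    show "x \<in> W \<Longrightarrow> x \<in> V1" for x
    proof (induction rule: main_class.induct)
      case (step x)
      then show ?case using f2 h2 not_both by blast
    qed (rule v1)
  qed
  have "x \<in> V1 \<Longrightarrow> x \<in> W" for x
  proof (induction "v1 - h (f x)" arbitrary: x rule: less_induct)
    case less
    define q where "q = h (f x)"
    have q: "q \<in> V1" using h1 f1 less.prems unfolding q_def by blast
    moreover have fx: "f x \<in> V1 \<union> V2" using f1 less.prems by blast
    ultimately have qv: "R1 q v1" using h(2) chain1 unfolding q_def by blast
    have "q \<in> W"
    proof (cases "f q = v1")
      case True
      then show ?thesis using W_f[of q] q main_class.base by auto
    next
      case False
      then obtain a where a: "a > q" "R1 a (f q)" "R1 a v1"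
        using conn1 qv unfolding conn_def by blast
      then have "R a (f q)" "R a v1" unfolding splice_order_def by auto
      then have "q < h (f q)" using h_ge a by fastforce
      moreover have "h (f q) \<le> v1" using h(2)[of "f q"] f1 q dom by blast
      ultimately have "v1 - h (f q) < v1 - h (f x)" unfolding q_def by simp
      then show ?thesis using less.hyps q by blast
    qed
    then show ?case using main_class.step less.prems unfolding q_def by blast
  qed
  then show "V1 \<subseteq> W" by blast
qed

lemma v2_eq: "v2 = Max {a \<in> V2. R a v1}"
  by (rule Max_eqI[symmetric]) (use B.fin chain2 B.dom B.refl v2 in auto)

text \<open>The invariant \<open>conn\<close> of the receiving tree thus survives a splice and can
  be read back when the splice is undone.\<close>

lemma conn2_iff:
  assumes n: "n \<in> V2"
  shows "conn f R n \<longleftrightarrow> conn f R2 n"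
proof
  assume c: "conn f R n"
  show "conn f R2 n" unfolding conn_def
  proof (intro allI impI)
    fix x assume x: "R2 x n \<and> f x \<noteq> n"
    then have xV: "x \<in> V2" "f x \<in> V2" using B.dom f2 by auto
    have "R x n" using x unfolding splice_order_def by blast
    then obtain a where a: "a > x" "R a (f x)" "R a n" using x c unfolding conn_def by blast
    show "\<exists>a>x. R2 a (f x) \<and> R2 a n"
    proof (cases "a \<in> V2")
      case True
      then show ?thesis using a R22 n xV by blast
    next
      case False
      then have "a \<in> V1" using a dom by blast
      \<comment> \<open>Since \<open>a\<close> is in \<open>V1\<close> while \<open>f x\<close> and
        \<open>n\<close> are in \<open>V2\<close>, each of the two has a chain vertex of
        \<open>V2\<close> beyond \<open>a\<close> above it; the smaller of these is above
        both.\<close>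
      then obtain b b' where b: "R2 b v2" "R2 b (f x)" "a < b" "R2 b' v2" "R2 b' n" "a < b'"
        using R12 a n xV by meson
      then have "R2 (min b b') (f x) \<and> R2 (min b b') n"
        using B.common_below by blast
      moreover have "min b b' > x" using a b by auto
      ultimately show ?thesis by blast
    qed
  qed
next
  assume c: "conn f R2 n"
  show "conn f R n" unfolding conn_def
  proof (intro allI impI)
    fix x assume x: "R x n \<and> f x \<noteq> n"
    show "\<exists>a>x. R a (f x) \<and> R a n"
    proof (cases "x \<in> V2")
      case True
      then have "R2 x n" using x R22 n by blast
      then obtain a where a: "a > x" "R2 a (f x)" "R2 a n" using x c unfolding conn_def by blast
      then show ?thesis unfolding splice_order_def by blast
    next
      case False
      then have xV: "x \<in> V1" using x dom by blast
      then obtain b where b: "R1 x v1" "R2 b v2" "R2 b n" "x < b" using R12 x n by blast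
      \<comment> \<open>The path from \<open>x\<close> to \<open>n\<close> passes through
        \<open>b\<close>, which also lies on the chain to \<open>v1\<close>; a witness for
        \<open>v1\<close> can therefore be cut down to one for \<open>n\<close>.\<close>
      have Rb: "R b v1" "R b n" using b chain2 B.dom unfolding splice_order_def by blast+
      show ?thesis
      proof (cases "f x = v1")
        case True
        then show ?thesis using Rb b by auto
      next
        case False
        then obtain a where a: "a > x" "R1 a (f x)" "R1 a v1"
          using conn1 b unfolding conn_def by blast
        then have "R a (f x)" "R a v1" unfolding splice_order_def by auto
        then have "R (min a b) (f x) \<and> R (min a b) n" using common_below Rb by blast
        then show ?thesis using a b by (metis min_less_iff_conj)
      qed
    qed
  qed
qed

end

section \<open>Splicing and splitting of trees\<close>

definition good_tree :: "(nat \<Rightarrow> nat) \<Rightarrow> itree \<Rightarrow> bool" where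
  "good_tree f T \<longleftrightarrow> inc_tree T \<and> compat f (fst T) (le T)"

definition spliceable :: "(nat \<Rightarrow> nat) \<Rightarrow> itree \<Rightarrow> nat \<Rightarrow> itree \<Rightarrow> nat \<Rightarrow> bool" where
  "spliceable f T1 m T2 v \<longleftrightarrow> good_tree f T1 \<and> good_tree f T2 \<and> fst T1 \<inter> fst T2 = {} \<and>
    m \<in> fst T1 \<and> v \<in> fst T2 \<and> v < m \<and> conn f (le T1) m"

locale block_max =
  fixes f :: "nat \<Rightarrow> nat"
  assumes idem: "\<And>x. f (f x) = f x"
begin

lemma spliceable_imp:
  assumes "spliceable f T1 m T2 v" "f m = m"
  shows "block_splice (fst T1) (le T1) (fst T2) (le T2) m v f"
  using assms idem unfolding spliceable_def good_tree_def
  by (intro block_splice.intro splice_orders.intro splice_orders_axioms.intro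
      block_splice_axioms.intro inc_tree_order) auto

lemma spl_good:
  assumes s: "spliceable f T1 m T2 v" "f m = m"
  shows "good_tree f (spl T1 m T2 v)" "fst (spl T1 m T2 v) = fst T1 \<union> fst T2"
    "n \<in> fst T2 \<Longrightarrow> conn f (le (spl T1 m T2 v)) n \<longleftrightarrow> conn f (le T2) n"
proof -
  interpret block_splice "fst T1" "le T1" "fst T2" "le T2" m v f by (rule spliceable_imp[OF s])
  have *: "inc_tree T1" "inc_tree T2" using s unfolding spliceable_def good_tree_def by auto
  note o = spl_order[OF * disj v1 v2]
  show "fst (spl T1 m T2 v) = fst T1 \<union> fst T2" by (rule o)
  show "good_tree f (spl T1 m T2 v)" unfolding good_tree_def using o comp by auto
  show "n \<in> fst T2 \<Longrightarrow> conn f (le (spl T1 m T2 v)) n \<longleftrightarrow> conn f (le T2) n"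
    using conn2_iff o by auto
qed

text \<open>The right-hand sides involve only the spliced tree and \<open>m\<close>, so the splice
  determines all its ingredients.\<close>

lemma spl_decode:
  assumes s: "spliceable f T1 m T2 v" "f m = m"
  defines "T \<equiv> spl T1 m T2 v"
  defines "U \<equiv> main_class (fst T) f (le T) m"
  shows "fst T1 = U" "fst T2 = fst T - U" "le T1 = restr (le T) U"
    "le T2 = restr (le T) (fst T - U)" "v = Max {a \<in> fst T - U. le T a m}"
proof -
  interpret block_splice "fst T1" "le T1" "fst T2" "le T2" m v f by (rule spliceable_imp[OF s])
  have *: "inc_tree T1" "inc_tree T2" using s unfolding spliceable_def good_tree_def by auto
  note o = spl_order[OF * disj v1 v2]
  show 1: "fst T1 = U" unfolding U_def T_def o using W_eq by simp
  show 2: "fst T2 = fst T - U" using disj unfolding 1[symmetric] T_def o by auto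
  show "le T1 = restr (le T) U" unfolding 1[symmetric] restr_def T_def o
  proof (intro ext)
    show "le T1 a x \<longleftrightarrow> a \<in> fst T1 \<and> x \<in> fst T1 \<and> R a x" for a x
      using R11[of a x] A.dom[of a x] by blast
  qed
  show "le T2 = restr (le T) (fst T - U)" unfolding 2[symmetric] unfolding restr_def T_def o
  proof (intro ext)
    show "le T2 a x \<longleftrightarrow> a \<in> fst T2 \<and> x \<in> fst T2 \<and> R a x" for a x
      using R22[of a x] B.dom[of a x] by blast
  qed
  show "v = Max {a \<in> fst T - U. le T a m}" unfolding 2[symmetric] using v2_eq unfolding T_def o .
qed

lemma spl_inj:
  assumes s: "spliceable f T1 m T2 v" "spliceable f T1' m T2' v'" "f m = m"
    and eq: "spl T1 m T2 v = spl T1' m T2' v'"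
  shows "T1 = T1' \<and> T2 = T2' \<and> v = v'"
proof -
  note d = spl_decode[OF s(1,3)] and d' = spl_decode[OF s(2,3), folded eq]
  have "T1 = T1'"
    by (rule inc_tree_eqI) (use s d(1,3) d'(1,3) in \<open>simp_all add: spliceable_def good_tree_def\<close>)
  moreover have "T2 = T2'"
    by (rule inc_tree_eqI) (use s d(2,4) d'(2,4) in \<open>simp_all add: spliceable_def good_tree_def\<close>)
  ultimately show ?thesis using d(5) d'(5) by simp
qed

text \<open>The two restricted orders of \<open>split\<close> come from trees by
  \<open>ex_tree\<close>; the vertex \<open>n\<close> ensures that the second one is
  nonempty.\<close>

lemma spl_ex:
  assumes g: "good_tree f T" and m: "m \<in> fst T" "f m = m"
    and n: "n \<in> fst T" "n \<notin> main_class (fst T) f (le T) m"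
  obtains T1 T2 v where "spliceable f T1 m T2 v" "T = spl T1 m T2 v"
    "fst T1 = main_class (fst T) f (le T) m"
proof -
  interpret inc_order "fst T" "le T" using g inc_tree_order unfolding good_tree_def by blast
  interpret block_order "fst T" "le T" f m
    by unfold_locales (use g m idem in \<open>auto simp: good_tree_def\<close>)
  note sp = split[OF n]
  define v where "v = Max {a \<in> fst T - W. le T a m}"
  obtain T1 where T1: "inc_tree T1" "fst T1 = W" "le T1 = restr (le T) W"
    using inc_order.ex_tree[OF sp(1)] by blast
  obtain T2 where T2: "inc_tree T2" "fst T2 = fst T - W" "le T2 = restr (le T) (fst T - W)"
    using inc_order.ex_tree[OF sp(2)] by blast
  have s: "spliceable f T1 m T2 v"
    using T1 T2 sp(3,4) main_class.base W_conn W_f W_sub f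
    unfolding spliceable_def good_tree_def compat_def v_def restr_def by auto
  moreover have "T = spl T1 m T2 v"
  proof (rule inc_tree_eqI)
    note o = spl_order[of T1 T2 m v]
    have *: "fst T1 \<inter> fst T2 = {}" "m \<in> fst T1" "v \<in> fst T2"
      using s unfolding spliceable_def by auto
    show "inc_tree T" using g unfolding good_tree_def by blast
    show "inc_tree (spl T1 m T2 v)" by (rule o[OF T1(1) T2(1) *])
    show "fst T = fst (spl T1 m T2 v)" using o(3)[OF T1(1) T2(1) *] T1 T2 W_sub by auto
    show "le T = le (spl T1 m T2 v)"
      using o(2)[OF T1(1) T2(1) *] sp(5) unfolding T1(3) T2(3) v_def by simp
  qed
  ultimately show thesis using that T1 by blast
qed

end

text \<open>This provides the vertex required by \<open>spl_ex\<close>: through \<open>conn\<close>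
  for the trees with index at least 2, through the root for index 1.\<close>

lemma (in block_max) main_notin:
  assumes T: "good_tree f T" and m: "m \<in> fst T" "f m = m" and n: "n \<in> fst T" "f n = n" "n \<noteq> m"
    and c: "conn f (le T) n \<or> n = Min (fst T)"
  shows "n \<notin> main_class (fst T) f (le T) m"
proof -
  interpret inc_order "fst T" "le T" using T inc_tree_order unfolding good_tree_def by blast
  interpret block_order "fst T" "le T" f m
    by unfold_locales (use T m idem in \<open>auto simp: good_tree_def\<close>)
  show ?thesis using other_main_notin min_notin n c by blast
qed

section \<open>The steps of the construction\<close>

locale indexed_blocks = block_max +
  fixes r k :: nat and \<mu> :: "nat \<Rightarrow> nat"
  assumes k: "2 \<le> k"
    and f_range: "x \<in> {1..r} \<Longrightarrow> f x \<in> {1..r} \<and> x \<le> f x"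
    and \<mu>_mono: "1 \<le> i \<Longrightarrow> i < j \<Longrightarrow> j \<le> k \<Longrightarrow> \<mu> i < \<mu> j"
    and \<mu>_cover: "x \<in> {1..r} \<Longrightarrow> \<exists>l\<in>{1..k}. f x = \<mu> l"
    and \<mu>_range: "l \<in> {1..k} \<Longrightarrow> \<mu> l \<in> {1..r} \<and> f (\<mu> l) = \<mu> l"
    and \<mu>_1: "\<mu> 1 = 1"
begin

lemma \<mu>_inj: "i \<in> {1..k} \<Longrightarrow> j \<in> {1..k} \<Longrightarrow> \<mu> i = \<mu> j \<Longrightarrow> i = j"
  using \<mu>_mono[of i j] \<mu>_mono[of j i] by (cases i j rule: linorder_cases) auto

lemma \<mu>_less_iff: "i \<in> {1..k} \<Longrightarrow> j \<in> {1..k} \<Longrightarrow> \<mu> i < \<mu> j \<longleftrightarrow> i < j"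
  using \<mu>_mono[of i j] \<mu>_mono[of j i] by (cases i j rule: linorder_cases) auto

text \<open>The indices still live before step \<open>i\<close>: index 1 is never discarded, and an
  index \<open>l\<close> between 2 and \<open>k - 1\<close> is discarded in step
  \<open>l\<close>.\<close>

definition idx :: "nat \<Rightarrow> nat set" where
  "idx i = insert 1 {i..k}"

lemma idx_Suc: "i \<le> k \<Longrightarrow> idx i = insert i (idx (Suc i))"
  unfolding idx_def by auto

text \<open>The invariant before step \<open>i\<close>. Besides its own block, a live tree contains
  only blocks absorbed in earlier steps, whose maxima are below \<open>\<mu> i\<close>. For
  \<open>i \<ge> 2\<close>, \<open>conn\<close> is not imposed on the tree with index 1. By
  \<open>run_surj\<close> every such state is reached, up to junk.\<close>

definition good :: "nat \<Rightarrow> (nat \<Rightarrow> itree) \<times> nat \<Rightarrow> bool" where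
  "good i st \<longleftrightarrow> (case st of (\<tau>, \<nu>) \<Rightarrow>
    (\<forall>l\<in>idx i. good_tree f (\<tau> l) \<and> \<mu> l \<in> fst (\<tau> l) \<and>
      (\<forall>x\<in>fst (\<tau> l). f x = \<mu> l \<or> f x < \<mu> i)) \<and>
    disjoint_family_on (\<lambda>l. fst (\<tau> l)) (idx i) \<and> (\<Union>l\<in>idx i. fst (\<tau> l)) = {1..r} \<and>
    (\<forall>l\<in>{i..k}. conn f (le (\<tau> l)) (\<mu> l)) \<and> \<nu> \<in> fst (\<tau> 1))"

lemma goodD:
  assumes "good i (\<tau>, \<nu>)"
  shows "l \<in> idx i \<Longrightarrow> good_tree f (\<tau> l)" "l \<in> idx i \<Longrightarrow> \<mu> l \<in> fst (\<tau> l)"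
    "l \<in> idx i \<Longrightarrow> x \<in> fst (\<tau> l) \<Longrightarrow> f x = \<mu> l \<or> f x < \<mu> i"
    "l \<in> idx i \<Longrightarrow> l' \<in> idx i \<Longrightarrow> l \<noteq> l' \<Longrightarrow> fst (\<tau> l) \<inter> fst (\<tau> l') = {}"
    "(\<Union>l\<in>idx i. fst (\<tau> l)) = {1..r}" "l \<in> {i..k} \<Longrightarrow> conn f (le (\<tau> l)) (\<mu> l)" "\<nu> \<in> fst (\<tau> 1)"
  using assms unfolding good_def disjoint_family_on_def by auto

lemma good_sub: "good i (\<tau>, \<nu>) \<Longrightarrow> l \<in> idx i \<Longrightarrow> fst (\<tau> l) \<subseteq> {1..r}"
  using goodD(5) by blast

lemma goodI:
  assumes "\<And>l. l \<in> idx i \<Longrightarrow> good_tree f (\<tau> l)" "\<And>l. l \<in> idx i \<Longrightarrow> \<mu> l \<in> fst (\<tau> l)"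
    "\<And>l x. l \<in> idx i \<Longrightarrow> x \<in> fst (\<tau> l) \<Longrightarrow> f x = \<mu> l \<or> f x < \<mu> i"
    "\<And>l l'. l \<in> idx i \<Longrightarrow> l' \<in> idx i \<Longrightarrow> l \<noteq> l' \<Longrightarrow> fst (\<tau> l) \<inter> fst (\<tau> l') = {}"
    "(\<Union>l\<in>idx i. fst (\<tau> l)) = {1..r}" "\<And>l. l \<in> {i..k} \<Longrightarrow> conn f (le (\<tau> l)) (\<mu> l)" "\<nu> \<in> fst (\<tau> 1)"
  shows "good i (\<tau>, \<nu>)"
  using assms unfolding good_def disjoint_family_on_def by simp

lemma good_owner:
  assumes "good i (\<tau>, \<nu>)" "x \<in> {1..r}"
  obtains l where "l \<in> idx i" "x \<in> fst (\<tau> l)"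
  using goodD(5)[OF assms(1)] assms(2) by blast

lemma good_owner_unique:
  "good i (\<tau>, \<nu>) \<Longrightarrow> l \<in> idx i \<Longrightarrow> l' \<in> idx i \<Longrightarrow> x \<in> fst (\<tau> l) \<Longrightarrow> x \<in> fst (\<tau> l') \<Longrightarrow> l = l'"
  using goodD(4) by blast

text \<open>Discarded trees remain in the family as junk, so states are compared only on live indices.\<close>

definition same :: "nat \<Rightarrow> (nat \<Rightarrow> itree) \<times> nat \<Rightarrow> (nat \<Rightarrow> itree) \<times> nat \<Rightarrow> bool" where
  "same i st st' \<longleftrightarrow> snd st = snd st' \<and> (\<forall>l\<in>idx i. fst st l = fst st' l)"

definition stp :: "nat \<Rightarrow> (nat \<Rightarrow> itree) \<times> nat \<Rightarrow> nat \<Rightarrow> (nat \<Rightarrow> itree) \<times> nat" where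
  "stp c st i = (case st of (\<tau>, \<nu>) \<Rightarrow>
     if c \<in> fst (\<tau> 1) \<union> fst (\<tau> i) then (\<tau>(1 := spl (\<tau> i) (\<mu> i) (\<tau> 1) \<nu>), c)
     else (let j = (THE j. i < j \<and> j \<le> k \<and> c \<in> fst (\<tau> j)) in
           (\<tau>(j := spl (\<tau> i) (\<mu> i) (\<tau> j) c), \<nu>)))"

lemma same_stp:
  assumes "same i st st'" "i \<le> k"
  shows "same (Suc i) (stp c st i) (stp c st' i)"
proof -
  obtain \<tau> \<nu> \<tau>' \<nu>' where st: "st = (\<tau>, \<nu>)" "st' = (\<tau>', \<nu>')" by (metis surj_pair)
  have eq: "\<nu>' = \<nu>" "l \<in> idx i \<Longrightarrow> \<tau>' l = \<tau> l" for l using assms unfolding same_def st by auto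
  have i: "\<tau>' 1 = \<tau> 1" "\<tau>' i = \<tau> i" using eq assms unfolding idx_def by auto
  have "(i < j \<and> j \<le> k \<and> c \<in> fst (\<tau>' j)) \<longleftrightarrow> (i < j \<and> j \<le> k \<and> c \<in> fst (\<tau> j))" for j
    using eq(2)[of j] unfolding idx_def by auto
  then have j: "(THE j. i < j \<and> j \<le> k \<and> c \<in> fst (\<tau>' j)) = (THE j. i < j \<and> j \<le> k \<and> c \<in> fst (\<tau> j))"
    by presburger
  show ?thesis
    using eq idx_Suc[OF assms(2)] unfolding st stp_def same_def Let_def j i prod.case by auto
qed

text \<open>Both branches of the step splice the \<open>i\<close>-th tree into the tree with index \<open>t\<close>;
  the code and the new marker only exchange roles.\<close>

lemma stp_cases:
  assumes g: "good i (\<tau>, \<nu>)" and i: "2 \<le> i" "i < k" and c: "c \<in> {1..\<mu> i}"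
  obtains t v \<nu>' where "t \<in> idx (Suc i)" "spliceable f (\<tau> i) (\<mu> i) (\<tau> t) v"
    "stp c (\<tau>, \<nu>) i = (\<tau>(t := spl (\<tau> i) (\<mu> i) (\<tau> t) v), \<nu>')"
    "if t = 1 then v = \<nu> \<and> \<nu>' = c \<and> c \<in> fst (\<tau> 1) \<union> fst (\<tau> i) else v = c \<and> \<nu>' = \<nu>"
proof -
  have ii: "i \<in> idx i" "1 \<in> idx i" "i \<in> {i..k}" "i \<in> {1..k}" "1 \<in> {1..k}" using i unfolding idx_def by auto
  note D = goodD[OF g]
  have sp: "spliceable f (\<tau> i) (\<mu> i) (\<tau> t) v" if "t \<in> idx i" "t \<noteq> i" "v \<in> fst (\<tau> t)" "v < \<mu> i" for t v
    unfolding spliceable_def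
    using D(1)[OF ii(1)] D(1)[OF that(1)] D(2)[OF ii(1)] D(4)[OF ii(1) that(1)] D(6)[OF ii(3)] that
    by auto
  show thesis
  proof (cases "c \<in> fst (\<tau> 1) \<union> fst (\<tau> i)")
    case True
    \<comment> \<open>All blocks in the first tree have maxima below \<open>\<mu> i\<close>, so the
      marker is an admissible splice point.\<close>
    have "f \<nu> < \<mu> i" using D(3)[OF ii(2) D(7)] \<mu>_mono[of 1 i] i by auto
    moreover have "\<nu> \<le> f \<nu>" using f_range D(7) good_sub[OF g ii(2)] by blast
    ultimately have "\<nu> < \<mu> i" by simp
    then have "spliceable f (\<tau> i) (\<mu> i) (\<tau> 1) \<nu>" using sp ii D(7) i by auto
    moreover have "1 \<in> idx (Suc i)" unfolding idx_def by simp
    moreover have "stp c (\<tau>, \<nu>) i = (\<tau>(1 := spl (\<tau> i) (\<mu> i) (\<tau> 1) \<nu>), c)"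
      unfolding stp_def using True by simp
    ultimately show thesis using that[of 1 \<nu> c] True by simp
  next
    case False
    have "c \<in> {1..r}" using c \<mu>_range ii by fastforce
    then obtain j where j: "j \<in> idx i" "c \<in> fst (\<tau> j)" using good_owner[OF g] by blast
    then have j': "i < j" "j \<le> k" using False unfolding idx_def by (auto simp: le_less)
    have "(THE j. i < j \<and> j \<le> k \<and> c \<in> fst (\<tau> j)) = j"
      by (rule the_equality) (use j j' good_owner_unique[OF g] in \<open>auto simp: idx_def\<close>)
    then have "stp c (\<tau>, \<nu>) i = (\<tau>(j := spl (\<tau> i) (\<mu> i) (\<tau> j) c), \<nu>)"
      unfolding stp_def using False by simp
    \<comment> \<open>As \<open>\<mu> i\<close> is a vertex of \<open>\<tau> i\<close>,
      \<open>c\<close> is strictly smaller, as the splice demands.\<close>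
    moreover have "c \<noteq> \<mu> i" using False D(2) ii by auto
    then have "spliceable f (\<tau> i) (\<mu> i) (\<tau> j) c" using sp j j' c by auto
    moreover have "j \<in> idx (Suc i)" using j' unfolding idx_def by simp
    ultimately show thesis using that[of j c \<nu>] j' i by auto
  qed
qed

text \<open>Raising the threshold from \<open>\<mu> i\<close> to \<open>\<mu> (Suc i)\<close>
  accounts for the block \<open>i\<close> now absorbed into the tree \<open>t\<close>; the surviving
  trees keep \<open>conn\<close> by \<open>conn2_iff\<close>.\<close>

lemma splice_good:
  assumes g: "good i (\<tau>, \<nu>)" and i: "2 \<le> i" "i < k" and t: "t \<in> idx (Suc i)"
    and s: "spliceable f (\<tau> i) (\<mu> i) (\<tau> t) v"
    and \<nu>': "\<nu>' \<in> fst (\<tau> 1) \<or> t = 1 \<and> \<nu>' \<in> fst (\<tau> i)"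
  shows "good (Suc i) (\<tau>(t := spl (\<tau> i) (\<mu> i) (\<tau> t) v), \<nu>')"
proof -
  note D = goodD[OF g]
  have fm: "f (\<mu> i) = \<mu> i" using \<mu>_range i by simp
  note S = spl_good[OF s fm]
  have ti: "t \<noteq> i" using t i unfolding idx_def by auto
  have sub: "l \<in> idx (Suc i) \<Longrightarrow> l \<in> idx i \<and> l \<noteq> i" for l using i unfolding idx_def by auto
  have ii: "i \<in> idx i" using i unfolding idx_def by auto
  have lt: "\<mu> i < \<mu> (Suc i)" using \<mu>_mono[of i "Suc i"] i by simp
  show ?thesis
  proof (rule goodI)
    fix l assume l: "l \<in> idx (Suc i)"
    show "good_tree f ((\<tau>(t := spl (\<tau> i) (\<mu> i) (\<tau> t) v)) l)" using S(1) D(1) sub l by auto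
    show "\<mu> l \<in> fst ((\<tau>(t := spl (\<tau> i) (\<mu> i) (\<tau> t) v)) l)" using S(2) D(2) sub l by auto
    show "f x = \<mu> l \<or> f x < \<mu> (Suc i)" if x: "x \<in> fst ((\<tau>(t := spl (\<tau> i) (\<mu> i) (\<tau> t) v)) l)" for x
    proof (cases "l = t \<and> x \<in> fst (\<tau> i)")
      case True
      then show ?thesis using D(3)[OF ii, of x] lt by auto
    next
      case False
      then have "x \<in> fst (\<tau> l)" using x S(2) by (auto split: if_splits)
      then show ?thesis using D(3)[of l x] sub l lt by auto
    qed
    show "fst ((\<tau>(t := spl (\<tau> i) (\<mu> i) (\<tau> t) v)) l) \<inter> fst ((\<tau>(t := spl (\<tau> i) (\<mu> i) (\<tau> t) v)) l') = {}"
      if l': "l' \<in> idx (Suc i)" "l \<noteq> l'" for l'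
      using D(4)[of l l'] D(4)[of l i] D(4)[of i l'] sub[OF l] sub[OF l'(1)] ii l'(2) S(2) by auto
  next
    show "(\<Union>l\<in>idx (Suc i). fst ((\<tau>(t := spl (\<tau> i) (\<mu> i) (\<tau> t) v)) l)) = {1..r}"
    proof -
      have "(\<Union>l\<in>idx (Suc i). fst ((\<tau>(t := spl (\<tau> i) (\<mu> i) (\<tau> t) v)) l))
        = fst (\<tau> i) \<union> (\<Union>l\<in>idx (Suc i). fst (\<tau> l))"
        using t S(2) by (auto split: if_splits)
      then show ?thesis using D(5) idx_Suc i by simp
    qed
  next
    fix l assume l: "l \<in> {Suc i..k}"
    then have "l \<in> idx i" unfolding idx_def by auto
    then show "conn f (le ((\<tau>(t := spl (\<tau> i) (\<mu> i) (\<tau> t) v)) l)) (\<mu> l)"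
      using S(3)[of "\<mu> l"] D(6)[of l] D(2)[of l] l by auto
  next
    show "\<nu>' \<in> fst ((\<tau>(t := spl (\<tau> i) (\<mu> i) (\<tau> t) v)) 1)"
      using \<nu>' S(2) by auto
  qed
qed

lemma stp_good:
  assumes g: "good i st" and i: "2 \<le> i" "i < k" and c: "c \<in> {1..\<mu> i}"
  shows "good (Suc i) (stp c st i)"
proof -
  obtain \<tau> \<nu> where st: "st = (\<tau>, \<nu>)" by (metis surj_pair)
  note g = g[unfolded st]
  obtain t v \<nu>' where *: "t \<in> idx (Suc i)" "spliceable f (\<tau> i) (\<mu> i) (\<tau> t) v"
    "stp c (\<tau>, \<nu>) i = (\<tau>(t := spl (\<tau> i) (\<mu> i) (\<tau> t) v), \<nu>')"
    "if t = 1 then v = \<nu> \<and> \<nu>' = c \<and> c \<in> fst (\<tau> 1) \<union> fst (\<tau> i) else v = c \<and> \<nu>' = \<nu>"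
    by (rule stp_cases[OF g i c])
  have "\<nu>' \<in> fst (\<tau> 1) \<or> t = 1 \<and> \<nu>' \<in> fst (\<tau> i)" using *(4) goodD(7)[OF g] by (auto split: if_splits)
  then show ?thesis unfolding st *(3) by (rule splice_good[OF g i *(1,2)])
qed

text \<open>The receiving index is recovered as that of the tree containing \<open>\<mu> i\<close>,
  and \<open>spl_inj\<close> then gives both trees and the splice point. For index 1 the splice
  point is the old marker and the new marker is the code; otherwise the splice point is the
  code.\<close>

lemma stp_inj:
  assumes g: "good i st" "good i st'" and i: "2 \<le> i" "i < k"
    and c: "c \<in> {1..\<mu> i}" "c' \<in> {1..\<mu> i}"
    and eq: "same (Suc i) (stp c st i) (stp c' st' i)"
  shows "same i st st' \<and> c = c'"
proof -
  obtain \<tau> \<nu> \<tau>' \<nu>' where st: "st = (\<tau>, \<nu>)" "st' = (\<tau>', \<nu>')" by (metis surj_pair)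
  note g = g[unfolded st]
  have fm: "f (\<mu> i) = \<mu> i" using \<mu>_range i by simp
  obtain t v n where 1: "t \<in> idx (Suc i)" "spliceable f (\<tau> i) (\<mu> i) (\<tau> t) v"
    "stp c (\<tau>, \<nu>) i = (\<tau>(t := spl (\<tau> i) (\<mu> i) (\<tau> t) v), n)"
    "if t = 1 then v = \<nu> \<and> n = c \<and> c \<in> fst (\<tau> 1) \<union> fst (\<tau> i) else v = c \<and> n = \<nu>"
    by (rule stp_cases[OF g(1) i c(1)])
  obtain t' v' n' where 2: "t' \<in> idx (Suc i)" "spliceable f (\<tau>' i) (\<mu> i) (\<tau>' t') v'"
    "stp c' (\<tau>', \<nu>') i = (\<tau>'(t' := spl (\<tau>' i) (\<mu> i) (\<tau>' t') v'), n')"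
    "if t' = 1 then v' = \<nu>' \<and> n' = c' \<and> c' \<in> fst (\<tau>' 1) \<union> fst (\<tau>' i) else v' = c' \<and> n' = \<nu>'"
    by (rule stp_cases[OF g(2) i c(2)])
  have n: "n = n'" and l: "\<And>l. l \<in> idx (Suc i) \<Longrightarrow>
      (\<tau>(t := spl (\<tau> i) (\<mu> i) (\<tau> t) v)) l = (\<tau>'(t' := spl (\<tau>' i) (\<mu> i) (\<tau>' t') v')) l"
    using eq unfolding st same_def 1(3) 2(3) by auto
  have "t = t'"
  proof (rule good_owner_unique)
    have "good (Suc i) (stp c (\<tau>, \<nu>) i)" by (rule stp_good[OF g(1) i c(1)])
    then show "good (Suc i) (\<tau>(t := spl (\<tau> i) (\<mu> i) (\<tau> t) v), n)" unfolding 1(3) .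
    show "\<mu> i \<in> fst ((\<tau>(t := spl (\<tau> i) (\<mu> i) (\<tau> t) v)) t)"
      using spl_good(2)[OF 1(2) fm] 1(2) unfolding spliceable_def by simp
    show "\<mu> i \<in> fst ((\<tau>(t := spl (\<tau> i) (\<mu> i) (\<tau> t) v)) t')"
      using spl_good(2)[OF 2(2) fm] 2(2) unfolding spliceable_def l[OF 2(1)] by simp
  qed (use 1 2 in auto)
  then have "spl (\<tau> i) (\<mu> i) (\<tau> t) v = spl (\<tau>' i) (\<mu> i) (\<tau>' t) v'" using l[OF 1(1)] by simp
  then have T: "\<tau> i = \<tau>' i" "\<tau> t = \<tau>' t" "v = v'"
    using spl_inj[OF 1(2) 2(2)[folded \<open>t = t'\<close>] fm] by auto
  have "\<tau> l = \<tau>' l" if "l \<in> idx i" for l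
    using l[of l] T that idx_Suc[of i] i \<open>t = t'\<close> by (cases "l = i"; cases "l = t") auto
  moreover have "\<nu> = \<nu>' \<and> c = c'" using 1(4) 2(4) n T \<open>t = t'\<close> by (auto split: if_splits)
  ultimately show ?thesis unfolding st same_def by auto
qed

text \<open>The class of \<open>\<mu> i\<close> is split off from the tree \<open>t\<close>
  containing it, and becomes the tree \<open>i\<close>; \<open>main_notin\<close> keeps
  \<open>\<mu> t\<close> in the remaining tree.\<close>

lemma stp_surj:
  assumes g: "good (Suc i) st'" and i: "2 \<le> i" "i < k"
  shows "\<exists>st c. good i st \<and> c \<in> {1..\<mu> i} \<and> same (Suc i) (stp c st i) st'"
proof -
  obtain \<sigma> \<nu>' where st': "st' = (\<sigma>, \<nu>')" by (metis surj_pair)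
  note g = g[unfolded st']
  note D = goodD[OF g]
  have fm: "f (\<mu> i) = \<mu> i" and mr: "\<mu> i \<in> {1..r}" using \<mu>_range[of i] i by auto
  obtain t where t: "t \<in> idx (Suc i)" "\<mu> i \<in> fst (\<sigma> t)" by (rule good_owner[OF g mr])
  have ik: "i \<in> {1..k}" and tk: "t \<in> {1..k}" and ti: "t \<noteq> i" using t i unfolding idx_def by auto
  have tne: "\<mu> t \<noteq> \<mu> i" using \<mu>_inj[OF tk ik] ti by blast
  have "\<mu> t \<notin> main_class (fst (\<sigma> t)) f (le (\<sigma> t)) (\<mu> i)"
  proof (rule main_notin[OF D(1)[OF t(1)] t(2) fm D(2)[OF t(1)] _ tne])
    show "f (\<mu> t) = \<mu> t" using \<mu>_range tk by blast
    show "conn f (le (\<sigma> t)) (\<mu> t) \<or> \<mu> t = Min (fst (\<sigma> t))"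
    proof (cases "t = 1")
      case True
      have sub: "fst (\<sigma> t) \<subseteq> {1..r}" by (rule good_sub[OF g t(1)])
      have "Min (fst (\<sigma> t)) = 1"
        by (rule Min_eqI) (use sub D(2)[OF t(1)] \<mu>_1 True finite_subset[OF sub] in auto)
      then show ?thesis using True \<mu>_1 by simp
    next
      case False
      then show ?thesis using D(6)[of t] t unfolding idx_def by auto
    qed
  qed
  then obtain T1 T2 v where s: "spliceable f T1 (\<mu> i) T2 v" "\<sigma> t = spl T1 (\<mu> i) T2 v"
    "fst T1 = main_class (fst (\<sigma> t)) f (le (\<sigma> t)) (\<mu> i)" and tT1: "\<mu> t \<notin> fst T1"
    using spl_ex[OF D(1)[OF t(1)] t(2) fm D(2)[OF t(1)]] by metis
  note S = spl_good[OF s(1) fm]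
  have sT: "good_tree f T1" "good_tree f T2" "fst T1 \<inter> fst T2 = {}" "\<mu> i \<in> fst T1" "v \<in> fst T2"
    "v < \<mu> i" "conn f (le T1) (\<mu> i)" using s unfolding spliceable_def by auto
  have V: "fst (\<sigma> t) = fst T1 \<union> fst T2" using S s by simp
  have tT2: "\<mu> t \<in> fst T2" using D(2)[OF t(1)] tT1 V by blast
  define \<tau> where "\<tau> = \<sigma>(t := T2, i := T1)"
  define \<nu> where "\<nu> = (if t = 1 then v else \<nu>')"
  define c where "c = (if t = 1 then \<nu>' else v)"
  have \<tau>: "\<tau> i = T1" "\<tau> t = T2" "l \<noteq> i \<Longrightarrow> l \<noteq> t \<Longrightarrow> \<tau> l = \<sigma> l" for l using ti unfolding \<tau>_def by auto
  have ii: "i \<in> idx i" "1 \<in> idx i" using i unfolding idx_def by auto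
  \<comment> \<open>No block maximum lies strictly between \<open>\<mu> i\<close> and
    \<open>\<mu> (Suc i)\<close>.\<close>
  have le_fm: "f x = \<mu> l \<or> f x \<le> \<mu> i" if "l \<in> idx (Suc i)" "x \<in> fst (\<sigma> l)" for l x
  proof -
    have "x \<in> {1..r}" using good_sub[OF g that(1)] that(2) by blast
    then obtain l' where l': "l' \<in> {1..k}" "f x = \<mu> l'" using \<mu>_cover by blast
    show ?thesis
    proof (cases "f x = \<mu> l")
      case False
      then have "l' < Suc i" using D(3)[OF that] \<mu>_less_iff[OF l'(1), of "Suc i"] i l' by auto
      then show ?thesis using \<mu>_less_iff[OF ik l'(1)] l' by (metis less_Suc_eq_le not_less)
    qed simp
  qed
  have cl: "f x \<in> fst T" if "good_tree f T" "x \<in> fst T" for T x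
    using that unfolding good_tree_def compat_def by blast
  have sub: "l \<in> idx i \<Longrightarrow> l \<noteq> i \<Longrightarrow> l \<in> idx (Suc i)" for l using idx_Suc[of i] i by auto
  have good: "good i (\<tau>, \<nu>)"
  proof (rule goodI)
    fix l assume l: "l \<in> idx i"
    show "good_tree f (\<tau> l)" using sT D(1) sub[OF l] \<tau> by metis
    show "\<mu> l \<in> fst (\<tau> l)" using sT D(2) sub[OF l] \<tau> tT2 by metis
    show "f x = \<mu> l \<or> f x < \<mu> i" if x: "x \<in> fst (\<tau> l)" for x
    proof (cases "l = i")
      case True
      then have "x \<in> fst T1" using x \<tau> by simp
      moreover from this have "f x \<noteq> \<mu> t" using cl[OF sT(1)] tT1 by metis
      ultimately show ?thesis using le_fm[OF t(1), of x] V True by auto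
    next
      case False
      then have "x \<in> fst (\<sigma> l)" using x \<tau> V by (cases "l = t") auto
      then have "f x = \<mu> l \<or> f x \<le> \<mu> i" using le_fm[OF sub[OF l False]] by blast
      moreover have "f x \<noteq> \<mu> i"
      proof (cases "l = t")
        case True
        then have "f x \<in> fst T2" using x \<tau> cl[OF sT(2)] by simp
        then show ?thesis using sT(3,4) by (metis disjoint_iff)
      next
        case l't: False
        then have "f x \<in> fst (\<sigma> l)" using cl[OF D(1)] sub[OF l False] \<open>x \<in> fst (\<sigma> l)\<close> by blast
        then show ?thesis using good_owner_unique[OF g sub[OF l False] t(1)] t(2) l't by metis
      qed
      ultimately show ?thesis by auto
    qed
    show "fst (\<tau> l) \<inter> fst (\<tau> l') = {}" if l': "l' \<in> idx i" "l \<noteq> l'" for l'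
    proof -
      have *: "fst (\<tau> a) \<inter> fst (\<sigma> b) = {}"
        if "a \<in> idx i" "b \<in> idx i" "a \<noteq> b" "b \<noteq> i" "b \<noteq> t" for a b
        using that \<tau> V D(4)[of a b] D(4)[of t b] sub t by (cases "a = i"; cases "a = t") auto
      show ?thesis
        using *[OF l l'(1)] *[OF l'(1) l] l'(2) \<tau> sT(3)
        by (cases "l = i"; cases "l' = i"; cases "l = t"; cases "l' = t") auto
    qed
  next
    have "(\<Union>l\<in>idx i. fst (\<tau> l)) = (\<Union>l\<in>idx (Suc i). fst (\<sigma> l))"
    proof -
      have "i \<notin> idx (Suc i)" using i unfolding idx_def by auto
      then have "(\<Union>l\<in>idx (Suc i) - {t}. fst (\<tau> l)) = (\<Union>l\<in>idx (Suc i) - {t}. fst (\<sigma> l))"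
        by (intro SUP_cong) (auto simp: \<tau>_def)
      then have "(\<Union>l\<in>idx (Suc i). fst (\<sigma> l)) = fst (\<sigma> t) \<union> (\<Union>l\<in>idx (Suc i) - {t}. fst (\<tau> l))"
        using t(1) by auto
      also have "\<dots> = fst (\<tau> i) \<union> (fst (\<tau> t) \<union> (\<Union>l\<in>idx (Suc i) - {t}. fst (\<tau> l)))"
        using V \<tau> by auto
      also have "\<dots> = (\<Union>l\<in>idx i. fst (\<tau> l))" using idx_Suc[of i] i t(1) by auto
      finally show ?thesis by simp
    qed
    then show "(\<Union>l\<in>idx i. fst (\<tau> l)) = {1..r}" using D(5) by simp
  next
    fix l assume l: "l \<in> {i..k}"
    consider "l = i" | "l = t" | "l \<noteq> i" "l \<noteq> t" by blast
    then show "conn f (le (\<tau> l)) (\<mu> l)"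
    proof cases
      case 1
      then show ?thesis using \<tau> sT by simp
    next
      case 2
      then have "t \<in> {Suc i..k}" using l ti by auto
      then show ?thesis using 2 D(6)[of t] S(3)[OF tT2] s(2) \<tau> by simp
    next
      case 3
      then show ?thesis using \<tau> D(6)[of l] l by simp
    qed
  next
    show "\<nu> \<in> fst (\<tau> 1)"
      unfolding \<nu>_def using sT D(7) \<tau> i by (cases "t = 1") auto
  qed
  have v1: "v \<in> {1..r}" using good_sub[OF g t(1)] V sT by blast
  \<comment> \<open>For \<open>t = 1\<close> the code is the marker, a vertex of the first tree,
    where all blocks have maxima at most \<open>\<mu> i\<close>; otherwise it is the splice point
    \<open>v < \<mu> i\<close>.\<close>
  have c: "c \<in> {1..\<mu> i}"
  proof (cases "t = 1")
    case True
    then have n: "\<nu>' \<in> fst (\<sigma> 1)" "1 \<in> idx (Suc i)" using D(7) t by auto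
    then have nr: "\<nu>' \<in> {1..r}" using good_sub[OF g] by blast
    have "f \<nu>' \<le> \<mu> i" using le_fm[OF n(2,1)] \<mu>_mono[of 1 i] i by auto
    then show ?thesis using nr f_range[OF nr] True unfolding c_def by auto
  next
    case False
    then show ?thesis using v1 sT unfolding c_def by auto
  qed
  \<comment> \<open>The case distinction of the step depends on the location of \<open>c\<close>; it
    must select \<open>t\<close> again. For \<open>t = 1\<close>, \<open>c\<close> is in
    \<open>\<tau> 1\<close> or \<open>\<tau> i\<close>, otherwise in
    \<open>\<tau> t\<close>.\<close>
  have "same (Suc i) (stp c (\<tau>, \<nu>) i) (\<sigma>, \<nu>')"
  proof (rule stp_cases[OF good i c])
    fix t' v' n
    assume a: "t' \<in> idx (Suc i)" "spliceable f (\<tau> i) (\<mu> i) (\<tau> t') v'"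
      "stp c (\<tau>, \<nu>) i = (\<tau>(t' := spl (\<tau> i) (\<mu> i) (\<tau> t') v'), n)"
      "if t' = 1 then v' = \<nu> \<and> n = c \<and> c \<in> fst (\<tau> 1) \<union> fst (\<tau> i) else v' = c \<and> n = \<nu>"
    have "t' = t \<and> v' = v \<and> n = \<nu>'"
    proof (cases "t = 1")
      case True
      then have cc: "c \<in> fst (\<tau> 1) \<or> c \<in> fst (\<tau> i)" using D(7) V \<tau> unfolding c_def by auto
      have "t' = 1"
      proof (rule ccontr)
        assume *: "t' \<noteq> 1"
        then have "c \<in> fst (\<tau> t')" using a unfolding spliceable_def by auto
        moreover have "t' \<in> idx i" "t' \<noteq> i" using a(1) i unfolding idx_def by auto
        ultimately show False using cc good_owner_unique[OF good] * ii by metis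
      qed
      then show ?thesis using a(4) True unfolding c_def \<nu>_def by auto
    next
      case False
      then have cc: "c \<in> fst (\<tau> t)" using sT \<tau> unfolding c_def by auto
      have ti': "t \<in> idx i" using t(1) unfolding idx_def by auto
      have "t' \<noteq> 1"
        using a(4) cc good_owner_unique[OF good ti' _ cc] ii False ti by (metis Un_iff)
      then have "c \<in> fst (\<tau> t')" using a unfolding spliceable_def by auto
      moreover have "t' \<in> idx i" using a(1) unfolding idx_def by auto
      ultimately have "t' = t" using good_owner_unique[OF good _ ti' _ cc] by blast
      then show ?thesis using a(4) False unfolding c_def \<nu>_def by auto
    qed
    then show ?thesis
      using a(3) s(2) \<tau> i unfolding same_def idx_def by auto
  qed
  then show ?thesis using good c unfolding st' by blast
qed

section \<open>The final splice\<close>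

definition finish :: "(nat \<Rightarrow> itree) \<times> nat \<Rightarrow> itree" where
  "finish st = spl (fst st k) (\<mu> k) (fst st 1) (snd st)"

lemma finish_spliceable:
  assumes g: "good k (\<tau>, \<nu>)"
  shows "spliceable f (\<tau> k) (\<mu> k) (\<tau> 1) \<nu>"
proof -
  note D = goodD[OF g]
  have kk: "k \<in> idx k" "1 \<in> idx k" "k \<in> {k..k}" "k \<noteq> 1" using k unfolding idx_def by auto
  have "f \<nu> < \<mu> k" using D(3)[OF kk(2) D(7)] \<mu>_mono[of 1 k] k by auto
  moreover have "\<nu> \<le> f \<nu>" using f_range D(7) good_sub[OF g kk(2)] by blast
  ultimately show ?thesis
    unfolding spliceable_def
    using D(1)[OF kk(1)] D(1)[OF kk(2)] D(2)[OF kk(1)] D(4)[OF kk(1,2,4)] D(6)[OF kk(3)] D(7) by auto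
qed

lemma f\<mu>k: "f (\<mu> k) = \<mu> k"
  using \<mu>_range k by simp

lemma finish_good:
  assumes "good k st"
  shows "good_tree f (finish st)" "fst (finish st) = {1..r}"
proof -
  obtain \<tau> \<nu> where st: "st = (\<tau>, \<nu>)" by (metis surj_pair)
  note g = assms[unfolded st]
  note S = spl_good[OF finish_spliceable[OF g] f\<mu>k]
  show "good_tree f (finish st)" using S unfolding finish_def st by simp
  have "idx k = {1, k}" unfolding idx_def by auto
  then show "fst (finish st) = {1..r}" using S goodD(5)[OF g] unfolding finish_def st by auto
qed

lemma finish_inj:
  assumes "good k st" "good k st'" "finish st = finish st'"
  shows "same k st st'"
proof -
  obtain \<tau> \<nu> \<tau>' \<nu>' where st: "st = (\<tau>, \<nu>)" "st' = (\<tau>', \<nu>')" by (metis surj_pair)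
  have "idx k = {1, k}" unfolding idx_def by auto
  then show ?thesis
    using spl_inj[OF finish_spliceable finish_spliceable f\<mu>k] assms
    unfolding finish_def st same_def by auto
qed

text \<open>The root 1 is a block of its own, hence outside the class of \<open>\<mu> k\<close>;
  splitting off this class leaves the first tree.\<close>

lemma finish_surj:
  assumes T: "good_tree f T" "fst T = {1..r}"
  shows "\<exists>st. good k st \<and> finish st = T"
proof -
  have k1: "\<mu> k \<in> fst T" "\<mu> 1 \<in> fst T" "f (\<mu> 1) = \<mu> 1" using \<mu>_range[of k] \<mu>_range[of 1] k T by auto
  have "\<mu> 1 \<noteq> \<mu> k" using \<mu>_mono[of 1 k] k by auto
  moreover have "Min (fst T) = \<mu> 1" by (rule Min_eqI) (use k1 T \<mu>_1 in auto)
  ultimately have "\<mu> 1 \<notin> main_class (fst T) f (le T) (\<mu> k)"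
    using main_notin[OF T(1) k1(1) f\<mu>k k1(2,3)] by simp
  then obtain T1 T2 v where s: "spliceable f T1 (\<mu> k) T2 v" "T = spl T1 (\<mu> k) T2 v"
      and n: "\<mu> 1 \<notin> fst T1"
    using spl_ex[OF T(1) k1(1) f\<mu>k k1(2)] by metis
  define \<tau> where "\<tau> = (\<lambda>l::nat. if l = 1 then T2 else T1)"
  have V: "fst T1 \<union> fst T2 = {1..r}" using spl_good(2)[OF s(1) f\<mu>k] s T by simp
  have idx: "idx k = {1, k}" "k \<noteq> 1" using k unfolding idx_def by auto
  have sT: "good_tree f T1" "good_tree f T2" "fst T1 \<inter> fst T2 = {}" "\<mu> k \<in> fst T1" "v \<in> fst T2"
    "conn f (le T1) (\<mu> k)" using s unfolding spliceable_def by auto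
  have fle: "f x = \<mu> k \<or> f x < \<mu> k" if x: "x \<in> {1..r}" for x
  proof -
    obtain l where "l \<in> {1..k}" "f x = \<mu> l" using \<mu>_cover x by blast
    then show ?thesis using \<mu>_mono[of l k] by (cases "l = k") auto
  qed
  have fT2: "f x < \<mu> k" if "x \<in> fst T2" for x
  proof -
    have "f x \<in> fst T2" using that sT(2) unfolding good_tree_def compat_def by blast
    then have "f x \<noteq> \<mu> k" using sT(3,4) by (metis disjoint_iff)
    moreover have "x \<in> {1..r}" using that V by blast
    ultimately show ?thesis using fle by blast
  qed
  have "good k (\<tau>, v)"
  proof (rule goodI)
    have \<tau>: "\<tau> 1 = T2" "\<tau> k = T1" using idx(2) unfolding \<tau>_def by auto
    have "\<mu> 1 \<in> fst T2" using k1 n V T by blast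
    then have live: "good_tree f (\<tau> l) \<and> \<mu> l \<in> fst (\<tau> l)" if "l \<in> idx k" for l
      using that sT(1,2,4) \<tau> unfolding idx by auto
    then show "l \<in> idx k \<Longrightarrow> good_tree f (\<tau> l)" "l \<in> idx k \<Longrightarrow> \<mu> l \<in> fst (\<tau> l)" for l by auto
    show "f x = \<mu> l \<or> f x < \<mu> k" if "l \<in> idx k" "x \<in> fst (\<tau> l)" for l x
    proof (cases "l = k")
      case True
      then have "x \<in> {1..r}" using that(2) V \<tau> by auto
      then show ?thesis using fle True by blast
    next
      case False
      then have "l = 1" using that(1) unfolding idx by blast
      then show ?thesis using that(2) fT2 \<tau> by auto
    qed
    show "fst (\<tau> l) \<inter> fst (\<tau> l') = {}" if "l \<in> idx k" "l' \<in> idx k" "l \<noteq> l'" for l l'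
      using that sT(3) \<tau> unfolding idx by auto
    show "(\<Union>l\<in>idx k. fst (\<tau> l)) = {1..r}" using V \<tau> unfolding idx by auto
    show "conn f (le (\<tau> l)) (\<mu> l)" if "l \<in> {k..k}" for l using that sT(6) \<tau> by simp
    show "v \<in> fst (\<tau> 1)" using sT(5) \<tau> by simp
  qed
  moreover have "finish (\<tau>, v) = T" using idx s unfolding finish_def \<tau>_def by simp
  ultimately show ?thesis by blast
qed

section \<open>The initial state\<close>

definition start :: "(nat \<Rightarrow> itree) \<times> nat" where
  "start = (\<lambda>l. chain_tree {x \<in> {1..r}. f x = \<mu> l}, 1)"

lemma idx_2: "idx 2 = {1..k}"
  using k unfolding idx_def by auto

lemma block_1: "{x \<in> {1..r}. f x = \<mu> 1} = {1}"
  using f_range \<mu>_range[of 1] \<mu>_1 k by fastforce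

lemma block_chain:
  assumes "l \<in> {1..k}"
  defines "S \<equiv> {x \<in> {1..r}. f x = \<mu> l}"
  shows "inc_tree (chain_tree S)" "le (chain_tree S) = (\<lambda>a x. a \<in> S \<and> x \<in> S \<and> a \<le> x)"
    "fst (chain_tree S) = S" "\<mu> l \<in> S"
proof -
  show 1: "\<mu> l \<in> S" unfolding S_def using \<mu>_range assms by auto
  have "finite S" "S \<noteq> {}" "0 \<notin> S" using 1 unfolding S_def by auto
  from chain_tree_order[OF this]
  show "inc_tree (chain_tree S)" "le (chain_tree S) = (\<lambda>a x. a \<in> S \<and> x \<in> S \<and> a \<le> x)" .
  show "fst (chain_tree S) = S" unfolding chain_tree_def by simp
qed

lemma start_good: "good 2 start"
  unfolding start_def
proof (rule goodI)
  fix l assume "l \<in> idx 2"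
  then have l: "l \<in> {1..k}" using idx_2 by simp
  note B = block_chain[OF l]
  show "good_tree f (chain_tree {x \<in> {1..r}. f x = \<mu> l})"
  proof -
    have "x \<le> \<mu> l" if "x \<in> {1..r}" "f x = \<mu> l" for x using f_range[OF that(1)] that(2) by simp
    then show ?thesis unfolding good_tree_def compat_def B(2,3) using B(1,4) by auto
  qed
  show "\<mu> l \<in> fst (chain_tree {x \<in> {1..r}. f x = \<mu> l})" using B by simp
  show "f x = \<mu> l \<or> f x < \<mu> 2" if "x \<in> fst (chain_tree {x \<in> {1..r}. f x = \<mu> l})" for x
    using that B by simp
  show "fst (chain_tree {x \<in> {1..r}. f x = \<mu> l}) \<inter> fst (chain_tree {x \<in> {1..r}. f x = \<mu> l'}) = {}"
    if "l' \<in> idx 2" "l \<noteq> l'" for l'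
    using B(3) block_chain(3)[of l'] that \<mu>_inj[OF l] idx_2 by auto
next
  show "(\<Union>l\<in>idx 2. fst (chain_tree {x \<in> {1..r}. f x = \<mu> l})) = {1..r}"
    using block_chain(3) \<mu>_cover unfolding idx_2 by auto
next
  fix l assume "l \<in> {2..k}"
  then have l: "l \<in> {1..k}" by simp
  \<comment> \<open>In a chain on a single block every vertex satisfies
    \<open>f x = \<mu> l\<close>, so the condition is vacuous.\<close>
  show "conn f (le (chain_tree {x \<in> {1..r}. f x = \<mu> l})) (\<mu> l)"
    unfolding conn_def block_chain(2)[OF l] by auto
next
  have "1 \<in> {1..k}" using k by simp
  then show "1 \<in> fst (chain_tree {x \<in> {1..r}. f x = \<mu> 1})"
    using block_chain(3)[of 1] block_1 by auto
qed

text \<open>The only block with maximum below \<open>\<mu> 2\<close> is \<open>{1}\<close>, so each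
  tree consists of its own block alone, and \<open>compat\<close> forces it to be a chain.\<close>

lemma good_2_unique:
  assumes "good 2 st"
  shows "same 2 start st"
proof -
  obtain \<tau> \<nu> where st: "st = (\<tau>, \<nu>)" by (metis surj_pair)
  note g = assms[unfolded st]
  note D = goodD[OF g]
  have one: "x = 1" if "x \<in> {1..r}" "f x < \<mu> 2" for x
  proof -
    obtain l where l: "l \<in> {1..k}" "f x = \<mu> l" using \<mu>_cover \<open>x \<in> {1..r}\<close> by blast
    then have "l = 1" using that \<mu>_less_iff[of l 2] k by auto
    then show ?thesis using block_1 l that by blast
  qed
  have V: "fst (\<tau> l) = {x \<in> {1..r}. f x = \<mu> l}" if l: "l \<in> {1..k}" for l
  proof (intro equalityI subsetI)
    fix x assume x: "x \<in> fst (\<tau> l)"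
    have xr: "x \<in> {1..r}" using good_sub[OF g] x l idx_2 by blast
    have "f x = \<mu> l"
    proof (cases "f x < \<mu> 2")
      case True
      then have "x = 1" using one xr by blast
      then have "l = 1" using good_owner_unique[OF g, of l 1 x] x l idx_2 D(2)[of 1] \<mu>_1 k by auto
      then show ?thesis using \<open>x = 1\<close> block_1 by blast
    next
      case False
      then show ?thesis using D(3)[of l x] l idx_2 x by auto
    qed
    then show "x \<in> {x \<in> {1..r}. f x = \<mu> l}" using xr by blast
  next
    fix x assume x: "x \<in> {x \<in> {1..r}. f x = \<mu> l}"
    then obtain l' where l': "l' \<in> idx 2" "x \<in> fst (\<tau> l')" using good_owner[OF g] by blast
    then have "\<mu> l \<in> fst (\<tau> l')" using D(1)[OF l'(1)] x unfolding good_tree_def compat_def by auto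
    then show "x \<in> fst (\<tau> l)" using good_owner_unique[OF g l'(1)] l' D(2) l idx_2 by metis
  qed
  have "\<tau> l = chain_tree {x \<in> {1..r}. f x = \<mu> l}" if l: "l \<in> {1..k}" for l
  proof (rule inc_tree_eqI)
    have gt: "good_tree f (\<tau> l)" using D(1) l idx_2 by blast
    then show 1: "inc_tree (\<tau> l)" unfolding good_tree_def by blast
    show "inc_tree (chain_tree {x \<in> {1..r}. f x = \<mu> l})" by (rule block_chain[OF l])
    show "fst (\<tau> l) = fst (chain_tree {x \<in> {1..r}. f x = \<mu> l})" using V block_chain(3) l by simp
    interpret inc_order "fst (\<tau> l)" "le (\<tau> l)" by (rule inc_tree_order[OF 1])
    have "le (\<tau> l) x (\<mu> l)" if "x \<in> fst (\<tau> l)" for x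
      using that gt V[OF l] unfolding good_tree_def compat_def by force
    then have "le (\<tau> l) a x \<longleftrightarrow> a \<in> fst (\<tau> l) \<and> x \<in> fst (\<tau> l) \<and> a \<le> x" for a x
      using dom lin by blast
    then show "le (\<tau> l) = le (chain_tree {x \<in> {1..r}. f x = \<mu> l})"
      unfolding block_chain(2)[OF l] V[OF l] by blast
  qed
  moreover have "\<nu> = 1" using D(7) V[of 1] block_1 k by auto
  ultimately show ?thesis unfolding same_def st start_def idx_2 by simp
qed

section \<open>Codes and the runs they determine\<close>

definition run :: "nat list \<Rightarrow> nat \<Rightarrow> (nat \<Rightarrow> itree) \<times> nat" where
  "run c i = foldl (\<lambda>st i. stp (c ! (i - 2)) st i) start [2..<i]"

definition codes :: "nat list set" where
  "codes = {c. length c = k - 2 \<and> (\<forall>i\<in>{2..k - 1}. c ! (i - 2) \<in> {1..\<mu> i})}"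

lemma run_2: "run c 2 = start"
  unfolding run_def by simp

lemma run_Suc: "2 \<le> i \<Longrightarrow> run c (Suc i) = stp (c ! (i - 2)) (run c i) i"
  unfolding run_def by simp

text \<open>The steps before \<open>i\<close> have not yet read the entry for step \<open>j\<close>,
  so \<open>run_surj\<close> can fill in a code one entry at a time.\<close>

lemma run_update: "i \<le> j \<Longrightarrow> run (c[j - 2 := x]) i = run c i"
  unfolding run_def by (rule foldl_cong) auto

lemma codes_nth: "c \<in> codes \<Longrightarrow> 2 \<le> i \<Longrightarrow> i < k \<Longrightarrow> c ! (i - 2) \<in> {1..\<mu> i}"
  unfolding codes_def by auto

lemma run_good:
  assumes "c \<in> codes" "2 \<le> i" "i \<le> k"
  shows "good i (run c i)"
  using assms(2,3)
proof (induction i rule: dec_induct)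
  case base
  then show ?case using start_good run_2 by simp
next
  case (step i)
  then show ?case using stp_good[of i] codes_nth[OF assms(1)] run_Suc by auto
qed

lemma run_inj:
  assumes c: "c \<in> codes" "c' \<in> codes" and i: "2 \<le> i"
  shows "i \<le> k \<Longrightarrow> same i (run c i) (run c' i) \<Longrightarrow> \<forall>j\<in>{2..<i}. c ! (j - 2) = c' ! (j - 2)"
  using i
proof (induction i rule: dec_induct)
  case (step i)
  then have "same i (run c i) (run c' i) \<and> c ! (i - 2) = c' ! (i - 2)"
    using run_good[OF c(1)] run_good[OF c(2)] codes_nth[OF c(1)] codes_nth[OF c(2)]
    by (intro stp_inj) (auto simp: run_Suc)
  then show ?case using step by (auto simp: less_Suc_eq)
qed simp

lemma same_trans: "same i a b \<Longrightarrow> same i b c \<Longrightarrow> same i a c"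
  unfolding same_def by auto

lemma run_surj:
  assumes "2 \<le> i"
  shows "i \<le> k \<Longrightarrow> good i st \<Longrightarrow> \<exists>c\<in>codes. same i (run c i) st"
  using assms
proof (induction i arbitrary: st rule: dec_induct)
  case base
  have "1 \<le> \<mu> l" if "l \<in> {2..k - 1}" for l using \<mu>_range[of l] that by auto
  \<comment> \<open>No entry has been read yet, so any admissible code serves.\<close>
  then have "replicate (k - 2) 1 \<in> codes" unfolding codes_def by (auto simp: nth_replicate)
  then show ?case using good_2_unique[OF base(2)] run_2 by metis
next
  case (step i)
  then obtain st0 x where 1: "good i st0" "x \<in> {1..\<mu> i}" "same (Suc i) (stp x st0 i) st"
    using stp_surj[of i st] by auto
  then obtain c where c: "c \<in> codes" "same i (run c i) st0"
    using step.IH[of st0] step.prems(1) by (metis Suc_leD)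
  have ik: "Suc i \<le> k" by (rule step.prems)
  define d where "d = c[i - 2 := x]"
  have len: "length c = k - 2" using c unfolding codes_def by blast
  have "d ! (j - 2) \<in> {1..\<mu> j}" if j: "j \<in> {2..k - 1}" for j
  proof (cases "j = i")
    case True
    then show ?thesis using 1(2) ik len step(1) unfolding d_def by simp
  next
    case False
    then have "j - 2 \<noteq> i - 2" using j step(1) by auto
    then show ?thesis using c(1) j unfolding d_def codes_def by simp
  qed
  then have "d \<in> codes" using len unfolding codes_def d_def by simp
  moreover have "run d (Suc i) = stp x (run c i) i"
    using run_Suc[OF step(1), of d] run_update[of i i c x] step(1) ik len unfolding d_def by simp
  moreover have "same (Suc i) (stp x (run c i) i) st"
    using same_trans[OF same_stp[OF c(2)] 1(3)] ik by simp
  ultimately show ?case by metis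
qed

lemma finish_run_bij:
  "bij_betw (\<lambda>c. finish (run c k)) codes {T. good_tree f T \<and> fst T = {1..r}}"
  unfolding bij_betw_def
proof
  show "inj_on (\<lambda>c. finish (run c k)) codes"
  proof (rule inj_onI)
    fix c c' assume c: "c \<in> codes" "c' \<in> codes" and e: "finish (run c k) = finish (run c' k)"
    have *: "\<forall>j\<in>{2..<k}. c ! (j - 2) = c' ! (j - 2)"
      using run_inj[OF c k] finish_inj[OF run_good[OF c(1) k] run_good[OF c(2) k] e] by simp
    show "c = c'"
    proof (rule nth_equalityI)
      show "length c = length c'" using c unfolding codes_def by simp
      show "c ! j = c' ! j" if "j < length c" for j
        using *[rule_format, of "j + 2"] that c unfolding codes_def by simp
    qed
  qed
  show "(\<lambda>c. finish (run c k)) ` codes = {T. good_tree f T \<and> fst T = {1..r}}"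
  proof (intro equalityI subsetI)
    fix T assume "T \<in> {T. good_tree f T \<and> fst T = {1..r}}"
    then obtain st where st: "good k st" "finish st = T" using finish_surj by blast
    then obtain c where "c \<in> codes" "same k (run c k) st" using run_surj[OF k] by blast
    moreover from this have "finish (run c k) = finish st"
      unfolding finish_def same_def idx_def by auto
    ultimately show "T \<in> (\<lambda>c. finish (run c k)) ` codes" using st by (intro image_eqI[of _ _ c]) simp_all
  qed (use finish_good run_good[OF _ k order.refl] in blast)
qed

end

section \<open>Set partitions with \<open>{1}\<close> as a block\<close>

text \<open>Outside the partition the map is the identity, so that idempotence holds for all natural
  numbers, as \<open>block_max\<close> demands.\<close>

definition block_Max :: "nat set set \<Rightarrow> nat \<Rightarrow> nat" where
  "block_Max \<pi> x = (if x \<in> \<Union>\<pi> then Max (THE B. B \<in> \<pi> \<and> x \<in> B) else x)"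

locale partition1 =
  fixes r :: nat and \<pi> :: "nat set set"
  assumes r: "r \<ge> 2" and \<pi>: "\<pi> \<in> Pi1 r"
begin

lemma part: "partition_on {1..r} \<pi>" and one: "{1} \<in> \<pi>"
  using \<pi> unfolding Pi1_def by auto

lemma union: "\<Union>\<pi> = {1..r}"
  using part unfolding partition_on_def by blast

lemma blockD: "B \<in> \<pi> \<Longrightarrow> finite B" "B \<in> \<pi> \<Longrightarrow> B \<noteq> {}" "B \<in> \<pi> \<Longrightarrow> B \<subseteq> {1..r}"
  using union part finite_subset[of B "{1..r}"] unfolding partition_on_def by auto

lemma block_eq: "B \<in> \<pi> \<Longrightarrow> B' \<in> \<pi> \<Longrightarrow> x \<in> B \<Longrightarrow> x \<in> B' \<Longrightarrow> B = B'"
  using part unfolding partition_on_def disjoint_def by blast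

lemma block_Max_eq: "B \<in> \<pi> \<Longrightarrow> x \<in> B \<Longrightarrow> block_Max \<pi> x = Max B"
proof -
  assume B: "B \<in> \<pi>" "x \<in> B"
  then have "(THE B. B \<in> \<pi> \<and> x \<in> B) = B" by (intro the_equality) (use block_eq in blast)+
  then show ?thesis using B unfolding block_Max_def by auto
qed

lemma Max_block: "B \<in> \<pi> \<Longrightarrow> Max B \<in> B"
  using blockD by simp

lemma inj_Max: "inj_on Max \<pi>"
  by (rule inj_onI) (metis Max_block block_eq)

lemma finite_\<pi>: "finite \<pi>"
  using finite_elements[OF _ part] by simp

lemma mu_props:
  shows "1 \<le> i \<Longrightarrow> i < j \<Longrightarrow> j \<le> card \<pi> \<Longrightarrow> mu \<pi> i < mu \<pi> j"
    and "mu \<pi> ` {1..card \<pi>} = Max ` \<pi>"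
proof -
  define ls where "ls = sorted_list_of_set (Max ` \<pi>)"
  have len: "length ls = card \<pi>" unfolding ls_def using card_image[OF inj_Max] by simp
  have mu: "mu \<pi> i = ls ! (i - 1)" for i unfolding mu_def ls_def ..
  have "sorted_wrt (<) ls" unfolding ls_def by simp
  then show "1 \<le> i \<Longrightarrow> i < j \<Longrightarrow> j \<le> card \<pi> \<Longrightarrow> mu \<pi> i < mu \<pi> j"
    unfolding mu using len sorted_wrt_nth_less[of "(<)" ls "i - 1" "j - 1"] by simp
  have "mu \<pi> ` {1..card \<pi>} = (\<lambda>i. ls ! i) ` {..<card \<pi>}"
  proof -
    have "(\<lambda>i. i - 1) ` {1..card \<pi>} = {..<card \<pi>}"
    proof (intro equalityI subsetI)
      fix x assume "x \<in> {..<card \<pi>}"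
      then show "x \<in> (\<lambda>i. i - 1) ` {1..card \<pi>}" by (intro image_eqI[of _ _ "Suc x"]) auto
    qed auto
    then show ?thesis unfolding mu by (metis (no_types, lifting) image_cong image_image)
  qed
  also have "\<dots> = set ls" using len by (auto simp: set_conv_nth)
  finally show "mu \<pi> ` {1..card \<pi>} = Max ` \<pi>" unfolding ls_def using finite_\<pi> by simp
qed

lemma card_ge: "2 \<le> card \<pi>"
proof -
  have "2 \<in> \<Union>\<pi>" using union r by simp
  then obtain B where B: "B \<in> \<pi>" "2 \<in> B" by blast
  then have "B \<noteq> {1}" by auto
  then have "card {B, {1}} = 2" by simp
  then show ?thesis using card_mono[OF finite_\<pi>, of "{B, {1}}"] B one by simp
qed

lemma mu_1: "mu \<pi> 1 = 1"
proof -
  have "1 \<in> Max ` \<pi>" using one by force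
  then obtain i where i: "i \<in> {1..card \<pi>}" "mu \<pi> i = 1" unfolding mu_props(2)[symmetric] by auto
  have "mu \<pi> 1 \<in> Max ` \<pi>" using mu_props(2) card_ge by auto
  then have "mu \<pi> 1 \<ge> 1" using Max_block blockD(3) by fastforce
  then show ?thesis using mu_props(1)[of 1 i] i by (cases "i = 1") auto
qed

sublocale indexed_blocks "block_Max \<pi>" r "card \<pi>" "mu \<pi>"
proof
  show "block_Max \<pi> (block_Max \<pi> x) = block_Max \<pi> x" for x
  proof (cases "x \<in> \<Union>\<pi>")
    case True
    then show ?thesis using block_Max_eq Max_block by auto
  qed (simp add: block_Max_def)
  show "2 \<le> card \<pi>" by (rule card_ge)
  fix x assume "x \<in> {1..r}"
  then obtain B where B: "B \<in> \<pi>" "x \<in> B" using union by blast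
  then show "block_Max \<pi> x \<in> {1..r} \<and> x \<le> block_Max \<pi> x"
    using block_Max_eq Max_block blockD by (metis Max_ge subsetD)
  have "Max B \<in> mu \<pi> ` {1..card \<pi>}" using B mu_props(2) by blast
  then show "\<exists>l\<in>{1..card \<pi>}. block_Max \<pi> x = mu \<pi> l" using block_Max_eq B by auto
next
  fix l assume "l \<in> {1..card \<pi>}"
  then have "mu \<pi> l \<in> Max ` \<pi>" using mu_props(2) by blast
  then obtain B where B: "B \<in> \<pi>" "mu \<pi> l = Max B" by blast
  then have "mu \<pi> l \<in> B" using Max_block by simp
  then show "mu \<pi> l \<in> {1..r} \<and> block_Max \<pi> (mu \<pi> l) = mu \<pi> l"
    using block_Max_eq[OF B(1)] blockD(3)[OF B(1)] B(2) by auto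
next
  show "mu \<pi> 1 = 1" by (rule mu_1)
qed (rule mu_props(1))

lemma blk_eq:
  assumes "l \<in> {1..card \<pi>}"
  shows "blk \<pi> l = {x \<in> {1..r}. block_Max \<pi> x = mu \<pi> l}"
proof -
  have "mu \<pi> l \<in> Max ` \<pi>" using mu_props(2) assms by blast
  then obtain B where B: "B \<in> \<pi>" "mu \<pi> l = Max B" by blast
  have "blk \<pi> l = B" unfolding blk_def
    by (rule the_equality) (use B inj_onD[OF inj_Max] in auto)
  moreover have "B = {x \<in> {1..r}. block_Max \<pi> x = Max B}"
  proof (intro equalityI subsetI)
    fix x assume x: "x \<in> {x \<in> {1..r}. block_Max \<pi> x = Max B}"
    then obtain B' where B': "B' \<in> \<pi>" "x \<in> B'" using union by blast
    then have "Max B' = Max B" using x block_Max_eq by auto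
    then show "x \<in> B" using inj_onD[OF inj_Max _ B'(1) B(1)] B' by blast
  qed (use block_Max_eq[OF B(1)] blockD(3)[OF B(1)] in auto)
  ultimately show ?thesis using B by simp
qed

lemma psi_step_eq: "psi_step \<pi> c st i = stp (c ! (i - 2)) st i"
  unfolding psi_step_def stp_def Let_def by (simp add: case_prod_beta)

text \<open>Requiring every element to be an ancestor of its block's maximum suffices: two such
  ancestors are comparable by \<open>lin\<close>.\<close>

lemma Eset_eq: "Eset r \<pi> = {T. good_tree (block_Max \<pi>) T \<and> fst T = {1..r}}"
proof -
  have "(\<forall>B\<in>\<pi>. \<forall>i\<in>B. \<forall>j\<in>B. i < j \<longrightarrow> anc (snd T) i j) \<longleftrightarrow> compat (block_Max \<pi>) (fst T) (le T)"
    if T: "inc_tree T" "fst T = {1..r}" for T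
  proof
    interpret inc_order "fst T" "le T" by (rule inc_tree_order[OF T(1)])
    assume a: "\<forall>B\<in>\<pi>. \<forall>i\<in>B. \<forall>j\<in>B. i < j \<longrightarrow> anc (snd T) i j"
    show "compat (block_Max \<pi>) (fst T) (le T)" unfolding compat_def
    proof
      fix x assume x: "x \<in> fst T"
      then obtain B where B: "B \<in> \<pi>" "x \<in> B" using union T by blast
      have fr: "block_Max \<pi> x \<in> fst T" using f_range x T by auto
      have "le T x (block_Max \<pi> x)"
      proof (cases "x = Max B")
        case True
        then show ?thesis using block_Max_eq B refl x by simp
      next
        case False
        then have "x < Max B" using B blockD(1) by (simp add: le_neq_implies_less)
        then have "anc (snd T) x (Max B)" using a B Max_block by blast
        then show ?thesis using block_Max_eq[OF B] x fr unfolding le_def by simp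
      qed
      then show "block_Max \<pi> x \<in> fst T \<and> le T x (block_Max \<pi> x)" using fr by blast
    qed
  next
    interpret inc_order "fst T" "le T" by (rule inc_tree_order[OF T(1)])
    assume c: "compat (block_Max \<pi>) (fst T) (le T)"
    show "\<forall>B\<in>\<pi>. \<forall>i\<in>B. \<forall>j\<in>B. i < j \<longrightarrow> anc (snd T) i j"
    proof (intro ballI impI)
      fix B i j assume B: "B \<in> \<pi>" "i \<in> B" "j \<in> B" "i < j"
      then have "i \<in> fst T" "j \<in> fst T" using blockD(3)[OF B(1)] T by auto
      then have "le T i (Max B)" "le T j (Max B)"
        using c block_Max_eq[OF B(1)] B(2,3) unfolding compat_def by metis+
      then have "le T i j" using lin[of i "Max B" j] B(4) by simp
      then show "anc (snd T) i j" unfolding le_def by blast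
    qed
  qed
  then show ?thesis unfolding Eset_def good_tree_def by blast
qed

text \<open>The initial families of \<open>psi\<close> and \<open>start\<close> are compared only on
  \<open>{1..k}\<close>, hence \<open>same\<close> instead of equality; the final splice reads live
  indices only.\<close>

lemma psi_eq: "psi \<pi> c = finish (run c (card \<pi>))"
proof -
  let ?init = "(\<lambda>l. chain_tree (blk \<pi> l), 1 :: nat)"
  have run: "same i (foldl (psi_step \<pi> c) ?init [2..<i]) (run c i)" if "2 \<le> i" "i \<le> card \<pi>" for i
    using that
  proof (induction i rule: dec_induct)
    case base
    then show ?case using blk_eq unfolding same_def idx_2 run_2 start_def by simp
  next
    case (step i)
    then show ?case using same_stp[of i] by (simp add: run_Suc psi_step_eq)
  qed
  show ?thesis
    using run[OF card_ge] unfolding psi_def finish_def Let_def same_def idx_def by simp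
qed

end

theorem theorem2p8:
  fixes r :: nat and \<pi> :: "nat set set"
  assumes "r \<ge> 2" and "\<pi> \<in> Pi1 r"
  shows "bij_betw (psi \<pi>) (Cset \<pi>) (Eset r \<pi>)"
proof -
  interpret partition1 r \<pi> by unfold_locales (use assms in auto)
  have "Cset \<pi> = codes" unfolding Cset_def codes_def ..
  then show ?thesis using finish_run_bij psi_eq[abs_def] Eset_eq by simp
qed

end
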